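(* Consider the exact magnetic system $(\mathbb{S}^\infty_{L^2},\mathcal{G}^{L^2},\mathrm{d}\alpha)$, where $\mathbb{S}^\infty_{L^2}$ is the unit sphere of $L^2(\mathbb{S}^1,\mathbb{C})$, $\mathcal G^{L^2}$ is the round metric and $\alpha_f(F)=\tfrac12\mathrm{Re}\langle \mathrm{i}f,F\rangle_{L^2}$. Its Mañé critical value is $$c(\mathbb{S}^\infty_{L^2},\mathcal{G}^{L^2},\mathrm{d}\alpha)=\tfrac12\|\alpha\|_\infty^2=\tfrac18 .$$ Moreover, let $q_0,q_1\in\mathbb{S}^\infty_{L^2}$, let $\langle q_0,q_1\rangle$ denote their $L^2$-Hermitian product, and for every $k>0$ let $\mathcal{G}_k(q_0,q_1)$ be the set of magnetic geodesics of this system with energy $k$ connecting $q_0$ and $q_1$. Then: 1. If $k>\tfrac18$, then $\mathcal{G}_k(q_0,q_1)\neq\varnothing$. 2. If $k=\tfrac18$, then $\mathcal{G}_k(q_0,q_1)\neq\varnothing$ if and only if $\langle q_0,q_1\rangle\neq 0$. 3. If $k<\tfrac18$, then: (a) if $|\langle q_0,q_1\rangle|>\sqrt{1-8k}$, then $\mathcal{G}_k(q_0,q_1)\neq\varnothing$; (b) if $|\langle q_0,q_1\rangle|=\sqrt{1-8k}$, then there are $a_k,b_k\in\mathbb{R}$ (depending only on $k$) with $b_k>0$ such that $\mathcal{G}_k(q_0,q_1)\neq\varnothing$ if and only if $\langle q_0,q_1\rangle=e^{\mathrm{i}(a_k+mb_k)}\sqrt{1-8k}$ for some $m\in\mathbb{Z}$;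 (c) if $|\langle q_0,q_1\rangle|<\sqrt{1-8k}$, then $\mathcal{G}_k(q_0,q_1)=\varnothing$.
   Context: **Sphere.** $\mathbb{S}^1=\mathbb{R}/\mathbb{Z}$, $\langle\cdot,\cdot\rangle_{L^2}$ is the standard Hermitian product on $L^2(\mathbb{S}^1,\mathbb{C})$, $\mathbb{S}^\infty_{L^2}=\{f\in L^2(\mathbb{S}^1,\mathbb{C}):\|f\|_{L^2}=1\}$, with $T_f\mathbb{S}^\infty_{L^2}=\{F\in L^2(\mathbb{S}^1,\mathbb{C}):\mathrm{Re}\langle f,F\rangle_{L^2}=0\}$. The metric $\mathcal{G}^{L^2}=\mathrm{Re}\langle\cdot,\cdot\rangle_{L^2}$ is the restriction of the Euclidean one. The one-form $\alpha$ is $\alpha_f(F)=\tfrac12\mathrm{Re}\langle \mathrm{i}f,F\rangle_{L^2}$, and $\|\alpha\|_\infty$ is the supremum over $f$ of the operator norm of $\alpha_f$. **Magnetic geodesics.** For a Riemannian Hilbert manifold $(M,g)$ and a closed two-form $\sigma$, the Lorentz force $Y:TM\to TM$ is defined by $g_q(Y_qu,v)=\sigma_q(u,v)$. A curve $\gamma:\mathbb{R}\to M$ is a magnetic geodesic of $(M,g,\sigma)$ if $\nabla_{\dot\gamma}\dot\gamma=Y_\gamma\dot\gamma$, with $\nabla$ the Levi-Civita connection. Its energy $\tfrac12 g_\gamma(\dot\gamma,\dot\gamma)$ is constant. It connects $q_0$ and $q_1$ if both points lie on $\gamma(\mathbb{R})$. **Mañé's critical value.** For an exact magnetic system $(M,g,\mathrm{d}\alpha)$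 put $L(q,v)=\tfrac12|v|^2-\alpha_q(v)$ and, for $k\in\mathbb{R}$ and $\gamma\in H^1([0,T],M)$, $S_{L+k}(\gamma)=\int_0^T\big(L(\gamma,\dot\gamma)+k\big)\,\mathrm{d}t$. Then $$c(M,g,\mathrm{d}\alpha)=\inf\{k\in\mathbb{R}: S_{L+k}(\gamma)\ge 0\ \ \forall T>0,\ \forall\gamma\in H^1([0,T],M)\text{ with }\gamma(0)=\gamma(T)\}.$$ *)

theory Defs
  imports "HOL-Analysis.Analysis"
begin

section \<open>The Hilbert space of square-integrable complex functions on the circle\<close>

text \<open>
  Functions on the circle are 1-periodic functions on the reals; integrals over the circle and
  null sets of the circle are taken on the fundamental domain from 0 to 1.
\<close>

definition circle :: "real measure"
  where "circle = restrict_space lborel {0..<1}"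

definition sq_integrable :: "(real \<Rightarrow> complex) \<Rightarrow> bool"
  where "sq_integrable f \<longleftrightarrow>
    f \<in> borel_measurable borel \<and> (\<forall>x. f (x + 1) = f x) \<and> integrable circle (\<lambda>x. (cmod (f x))\<^sup>2)"

lemma space_circle [simp]: "space circle = {0..<1}"
  by (simp add: circle_def space_restrict_space)

lemma emeasure_space_circle: "emeasure circle (space circle) = 1"
  by (simp add: circle_def emeasure_restrict_space space_restrict_space)

interpretation circle: finite_measure circle
  by (rule finite_measureI) (simp only: emeasure_space_circle, simp)

lemma measurable_circle [measurable (raw)]: "f \<in> borel_measurable borel \<Longrightarrow> f \<in> borel_measurable circle"
  unfolding circle_def by (intro measurable_restrict_space1) simp

lemma sq_integrable_measurable: "sq_integrable f \<Longrightarrow> f \<in> borel_measurable circle"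
  by (auto simp: sq_integrable_def intro: measurable_circle)

lemma sq_integrable_zero: "sq_integrable (\<lambda>_. 0)"
  by (simp add: sq_integrable_def)

lemma cmod_add_sq_le: "(cmod (a + b))\<^sup>2 \<le> 2 * (cmod a)\<^sup>2 + 2 * (cmod b)\<^sup>2"
proof -
  have "(cmod (a + b))\<^sup>2 \<le> (cmod a + cmod b)\<^sup>2"
    by (intro power_mono norm_triangle_ineq) simp
  also have "\<dots> \<le> 2 * (cmod a)\<^sup>2 + 2 * (cmod b)\<^sup>2"
    using zero_le_power2[of "cmod a - cmod b"] by (simp add: power2_eq_square algebra_simps)
  finally show ?thesis .
qed

lemma sq_integrable_add:
  assumes "sq_integrable f" "sq_integrable g" shows "sq_integrable (\<lambda>x. f x + g x)"
proof -
  have [measurable]: "f \<in> borel_measurable borel" "g \<in> borel_measurable borel"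
    using assms by (auto simp: sq_integrable_def)
  have "integrable circle (\<lambda>x. (cmod (f x + g x))\<^sup>2)"
  proof (rule Bochner_Integration.integrable_bound)
    show "integrable circle (\<lambda>x. 2 * (cmod (f x))\<^sup>2 + 2 * (cmod (g x))\<^sup>2)"
      using assms by (auto simp: sq_integrable_def)
    show "(\<lambda>x. (cmod (f x + g x))\<^sup>2) \<in> borel_measurable circle"
      by (rule measurable_circle) measurable
  qed (use cmod_add_sq_le in auto)
  then show ?thesis using assms by (auto simp: sq_integrable_def)
qed

lemma sq_integrable_scale:
  assumes "sq_integrable f" shows "sq_integrable (\<lambda>x. c * f x)"
  using assms by (auto simp: sq_integrable_def norm_mult power_mult_distrib)

lemma sq_integrable_scale':
  assumes "sq_integrable f" shows "sq_integrable (\<lambda>x. f x * c)"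
  using sq_integrable_scale[OF assms, of c] by (simp add: mult.commute)

lemma borel_measurable_cnj [measurable (raw)]:
  "f \<in> borel_measurable M \<Longrightarrow> (\<lambda>x. cnj (f x)) \<in> borel_measurable M"
  by (rule borel_measurable_continuous_on[OF continuous_on_cnj[OF continuous_on_id]])

lemma sq_integrable_mult:
  assumes "sq_integrable f" "sq_integrable g" shows "integrable circle (\<lambda>x. f x * cnj (g x))"
proof -
  have [measurable]: "f \<in> borel_measurable borel" "g \<in> borel_measurable borel"
    using assms by (auto simp: sq_integrable_def)
  show ?thesis
  proof (rule Bochner_Integration.integrable_bound)
    show "integrable circle (\<lambda>x. (cmod (f x))\<^sup>2 + (cmod (g x))\<^sup>2)"
      using assms by (auto simp: sq_integrable_def)
    show "(\<lambda>x. f x * cnj (g x)) \<in> borel_measurable circle"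
      by (rule measurable_circle) measurable
    have "cmod (f x * cnj (g x)) \<le> (cmod (f x))\<^sup>2 + (cmod (g x))\<^sup>2" for x
    proof -
      have "2 * (cmod (f x) * cmod (g x)) \<le> (cmod (f x))\<^sup>2 + (cmod (g x))\<^sup>2"
        using zero_le_power2[of "cmod (f x) - cmod (g x)"] by (simp add: power2_diff)
      moreover have "0 \<le> cmod (f x) * cmod (g x)" by simp
      ultimately have "cmod (f x) * cmod (g x) \<le> (cmod (f x))\<^sup>2 + (cmod (g x))\<^sup>2" by linarith
      then show ?thesis by (simp add: norm_mult)
    qed
    then show "AE x in circle. norm (f x * cnj (g x)) \<le> norm ((cmod (f x))\<^sup>2 + (cmod (g x))\<^sup>2)"
      by auto
  qed
qed

definition L2S1_rel :: "(real \<Rightarrow> complex) \<Rightarrow> (real \<Rightarrow> complex) \<Rightarrow> bool"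
  where "L2S1_rel f g \<longleftrightarrow> sq_integrable f \<and> sq_integrable g \<and> (AE x in circle. f x = g x)"

lemma part_equivp_L2S1_rel: "part_equivp L2S1_rel"
proof (rule part_equivpI)
  show "\<exists>f. L2S1_rel f f" by (rule exI[of _ "\<lambda>_. 0"]) (simp add: L2S1_rel_def sq_integrable_zero)
  show "symp L2S1_rel" by (auto simp: symp_def L2S1_rel_def)
  show "transp L2S1_rel" by (auto simp: transp_def L2S1_rel_def elim: AE_mp)
qed

text \<open>Square-integrable functions up to equality almost everywhere.\<close>

quotient_type L2S1 = "real \<Rightarrow> complex" / partial: L2S1_rel
  by (rule part_equivp_L2S1_rel)

text \<open>The Hermitian product, linear in the first argument.\<close>

lift_definition hprod :: "L2S1 \<Rightarrow> L2S1 \<Rightarrow> complex"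
  is "\<lambda>f g. \<integral>x. f x * cnj (g x) \<partial>circle"
  by (rule integral_cong_AE)
    (auto simp: L2S1_rel_def dest!: sq_integrable_measurable)

lift_definition scaleC :: "complex \<Rightarrow> L2S1 \<Rightarrow> L2S1"  (infixr \<open>*\<^sub>C\<close> 75)
  is "\<lambda>c f x. c * f x"
  by (auto simp: L2S1_rel_def intro: sq_integrable_scale)

instantiation L2S1 :: real_vector
begin

lift_definition zero_L2S1 :: L2S1 is "\<lambda>_. 0"
  by (simp add: L2S1_rel_def sq_integrable_zero)

lift_definition plus_L2S1 :: "L2S1 \<Rightarrow> L2S1 \<Rightarrow> L2S1" is "\<lambda>f g x. f x + g x"
  by (auto simp: L2S1_rel_def intro: sq_integrable_add)

definition uminus_L2S1 :: "L2S1 \<Rightarrow> L2S1" where "- f = scaleC (- 1) f"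

definition minus_L2S1 :: "L2S1 \<Rightarrow> L2S1 \<Rightarrow> L2S1" where "f - g = f + - g" for f g :: L2S1

definition scaleR_L2S1 :: "real \<Rightarrow> L2S1 \<Rightarrow> L2S1" where "r *\<^sub>R f = scaleC (complex_of_real r) f"

instance
proof
  fix f g h :: L2S1 and a b :: real
  show "f + g + h = f + (g + h)"
    by transfer (auto simp: L2S1_rel_def add.assoc intro: sq_integrable_add)
  show "f + g = g + f"
    by transfer (auto simp: L2S1_rel_def add.commute intro: sq_integrable_add)
  show "0 + f = f"
    by transfer (auto simp: L2S1_rel_def)
  show "- f + f = 0"
    unfolding uminus_L2S1_def
    by transfer (auto simp: L2S1_rel_def sq_integrable_zero)
  show "f - g = f + - g"
    by (rule minus_L2S1_def)
  show "a *\<^sub>R (f + g) = a *\<^sub>R f + a *\<^sub>R g"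
    unfolding scaleR_L2S1_def
    by transfer (auto simp: L2S1_rel_def algebra_simps intro!: sq_integrable_add sq_integrable_scale sq_integrable_scale')
  show "(a + b) *\<^sub>R f = a *\<^sub>R f + b *\<^sub>R f"
    unfolding scaleR_L2S1_def
    by transfer (auto simp: L2S1_rel_def algebra_simps intro!: sq_integrable_add sq_integrable_scale sq_integrable_scale')
  show "a *\<^sub>R b *\<^sub>R f = (a * b) *\<^sub>R f"
    unfolding scaleR_L2S1_def
    by transfer (auto simp: L2S1_rel_def algebra_simps intro!: sq_integrable_add sq_integrable_scale sq_integrable_scale')
  show "1 *\<^sub>R f = f"
    unfolding scaleR_L2S1_def
    by transfer (auto simp: L2S1_rel_def)
qed

end

lemma scaleC_add_right: "c *\<^sub>C (f + g) = c *\<^sub>C f + c *\<^sub>C g"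
  by transfer (auto simp: L2S1_rel_def algebra_simps intro!: sq_integrable_add sq_integrable_scale sq_integrable_scale')

lemma scaleC_add_left: "(c + d) *\<^sub>C f = c *\<^sub>C f + d *\<^sub>C f"
  by transfer (auto simp: L2S1_rel_def algebra_simps intro!: sq_integrable_add sq_integrable_scale sq_integrable_scale')

lemma scaleC_scaleC [simp]: "c *\<^sub>C d *\<^sub>C f = (c * d) *\<^sub>C f"
  by transfer (auto simp: L2S1_rel_def algebra_simps intro!: sq_integrable_scale sq_integrable_scale')

lemma scaleC_one [simp]: "1 *\<^sub>C f = f"
  by transfer (auto simp: L2S1_rel_def)

lemma hprod_cnj: "cnj (hprod f g) = hprod g f"
  by transfer (simp flip: Bochner_Integration.integral_cnj add: mult.commute)

lemma hprod_add_left: "hprod (f + g) h = hprod f h + hprod g h"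
  by transfer (simp add: L2S1_rel_def algebra_simps sq_integrable_mult)

lemma hprod_scaleC_left: "hprod (c *\<^sub>C f) g = c * hprod f g"
  by transfer (simp add: mult.assoc)

lemma hprod_scaleC_right: "hprod f (c *\<^sub>C g) = cnj c * hprod f g"
  by (metis complex_cnj_mult hprod_cnj hprod_scaleC_left)

lemma hprod_self: "hprod f f = complex_of_real (Re (hprod f f))" "0 \<le> Re (hprod f f)"
proof -
  have *: "\<exists>r\<ge>0. hprod f f = complex_of_real r"
  proof (transfer, goal_cases)
    case (1 f)
    have "(\<integral>x. f x * cnj (f x) \<partial>circle) = complex_of_real (\<integral>x. (cmod (f x))\<^sup>2 \<partial>circle)"
      by (simp add: complex_norm_square[symmetric] flip: integral_complex_of_real of_real_power)
    then show ?case by (intro exI[of _ "\<integral>x. (cmod (f x))\<^sup>2 \<partial>circle"]) simp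
  qed
  then show "hprod f f = complex_of_real (Re (hprod f f))" "0 \<le> Re (hprod f f)" by auto
qed

lemma hprod_self_eq_0: "Re (hprod f f) = 0 \<longleftrightarrow> f = 0"
proof (transfer, goal_cases)
  case (1 f)
  then have f: "sq_integrable f" by (simp add: L2S1_rel_def)
  have "(\<integral>x. f x * cnj (f x) \<partial>circle) = complex_of_real (\<integral>x. (cmod (f x))\<^sup>2 \<partial>circle)"
    by (simp add: complex_norm_square[symmetric] flip: integral_complex_of_real of_real_power)
  moreover have "(\<integral>x. (cmod (f x))\<^sup>2 \<partial>circle) = 0 \<longleftrightarrow> (AE x in circle. (cmod (f x))\<^sup>2 = 0)"
    using f by (intro integral_nonneg_eq_0_iff_AE) (auto simp: sq_integrable_def)
  ultimately show ?case using f by (simp add: L2S1_rel_def sq_integrable_zero)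
qed

instantiation L2S1 :: real_inner
begin

definition inner_L2S1 :: "L2S1 \<Rightarrow> L2S1 \<Rightarrow> real" where "inner f g = Re (hprod f g)"

definition norm_L2S1 :: "L2S1 \<Rightarrow> real" where "norm f = sqrt (inner f f)" for f :: L2S1

definition dist_L2S1 :: "L2S1 \<Rightarrow> L2S1 \<Rightarrow> real" where "dist f g = norm (f - g)" for f g :: L2S1

definition sgn_L2S1 :: "L2S1 \<Rightarrow> L2S1" where "sgn f = inverse (norm f) *\<^sub>R f" for f :: L2S1

definition uniformity_L2S1 :: "(L2S1 \<times> L2S1) filter"
  where "uniformity_L2S1 = (INF e\<in>{0<..}. principal {(f, g). dist f g < e})"

definition open_L2S1 :: "L2S1 set \<Rightarrow> bool"
  where "open_L2S1 U \<longleftrightarrow> (\<forall>x\<in>U. \<forall>\<^sub>F (x', y) in uniformity. x' = x \<longrightarrow> y \<in> U)"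

instance
proof
  fix f g h :: L2S1 and r :: real and U :: "L2S1 set"
  show "inner f g = inner g f"
    using hprod_cnj[of f g] by (simp add: inner_L2S1_def complex_eq_iff)
  show "inner (f + g) h = inner f h + inner g h"
    by (simp add: inner_L2S1_def hprod_add_left)
  show "inner (r *\<^sub>R f) g = r * inner f g"
    by (simp add: inner_L2S1_def scaleR_L2S1_def hprod_scaleC_left)
  show "0 \<le> inner f f" "inner f f = 0 \<longleftrightarrow> f = 0"
    by (simp_all add: inner_L2S1_def hprod_self(2) hprod_self_eq_0)
qed (fact norm_L2S1_def dist_L2S1_def sgn_L2S1_def uniformity_L2S1_def open_L2S1_def)+

end


lemma L2S1_rel_self [simp]: "L2S1_rel f f \<longleftrightarrow> sq_integrable f"
  by (auto simp: L2S1_rel_def)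

lemma abs_L2S1_cases: obtains s where "sq_integrable s" "f = abs_L2S1 s"
  using Quotient_abs_rep[OF Quotient_L2S1, of f] Quotient_rep_reflp[OF Quotient_L2S1, of f]
  by (metis L2S1_rel_self)

lemma abs_L2S1_add: "sq_integrable f \<Longrightarrow> sq_integrable g \<Longrightarrow> abs_L2S1 f + abs_L2S1 g = abs_L2S1 (\<lambda>x. f x + g x)"
  by (simp add: plus_L2S1.abs_eq)

lemma abs_L2S1_scaleC: "sq_integrable f \<Longrightarrow> c *\<^sub>C abs_L2S1 f = abs_L2S1 (\<lambda>x. c * f x)"
  by (simp add: scaleC.abs_eq)

lemma sq_integrable_diff:
  "sq_integrable f \<Longrightarrow> sq_integrable g \<Longrightarrow> sq_integrable (\<lambda>x. f x - g x)"
  using sq_integrable_add[OF _ sq_integrable_scale[of g "-1"], of f] by simp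

lemma abs_L2S1_diff: "sq_integrable f \<Longrightarrow> sq_integrable g \<Longrightarrow> abs_L2S1 f - abs_L2S1 g = abs_L2S1 (\<lambda>x. f x - g x)"
  by (simp add: minus_L2S1_def uminus_L2S1_def abs_L2S1_scaleC abs_L2S1_add sq_integrable_scale[of g "-1", simplified])

lemma norm_abs_L2S1:
  assumes "sq_integrable f" shows "(norm (abs_L2S1 f))\<^sup>2 = (\<integral>x. (cmod (f x))\<^sup>2 \<partial>circle)"
proof -
  have "hprod (abs_L2S1 f) (abs_L2S1 f) = complex_of_real (\<integral>x. (cmod (f x))\<^sup>2 \<partial>circle)"
    using assms
    by (simp add: hprod.abs_eq complex_norm_square[symmetric] flip: integral_complex_of_real of_real_power)
  then show ?thesis by (simp add: power2_norm_eq_inner inner_L2S1_def)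
qed

lemma frac_measurable [measurable]: "(frac :: real \<Rightarrow> real) \<in> borel_measurable borel"
  unfolding frac_def by measurable

lemma integrable_circle_frac:
  "integrable circle (\<lambda>x. g (frac x)) \<longleftrightarrow> integrable circle (g :: real \<Rightarrow> real)"
  by (intro Bochner_Integration.integrable_cong) (auto simp: frac_eq)

lemma sq_integrable_periodize:
  assumes [measurable]: "f \<in> borel_measurable borel" and "integrable circle (\<lambda>x. (cmod (f x))\<^sup>2)"
  shows "sq_integrable (\<lambda>x. f (frac x))"
  using assms(2) unfolding sq_integrable_def
  by (auto simp: frac_1_eq integrable_circle_frac[of "\<lambda>x. (cmod (f x))\<^sup>2"])

lemma L1_less_of_L2_less:
  assumes h: "sq_integrable h" and e: "e > 0" and n: "norm (abs_L2S1 h) < e"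
  shows "(\<integral>x. cmod (h x) \<partial>circle) < e"
proof -
  have [measurable]: "h \<in> borel_measurable borel" using h by (simp add: sq_integrable_def)
  have i: "integrable circle (\<lambda>x. e / 2 + (cmod (h x))\<^sup>2 / (2 * e))"
    using h by (simp add: sq_integrable_def)
  have le: "cmod (h x) \<le> e / 2 + (cmod (h x))\<^sup>2 / (2 * e)" for x
    using e zero_le_power2[of "cmod (h x) - e"] by (simp add: power2_eq_square field_simps)
  have "integrable circle (\<lambda>x. cmod (h x))"
    by (rule Bochner_Integration.integrable_bound[OF i]) (use le in \<open>auto intro: order_trans[OF _ abs_ge_self]\<close>)
  then have "(\<integral>x. cmod (h x) \<partial>circle) \<le> (\<integral>x. e / 2 + (cmod (h x))\<^sup>2 / (2 * e) \<partial>circle)"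
    by (intro integral_mono i le)
  also have "\<dots> = e / 2 + (norm (abs_L2S1 h))\<^sup>2 / (2 * e)"
    using h emeasure_space_circle by (simp add: norm_abs_L2S1 sq_integrable_def measure_def)
  also have "\<dots> < e / 2 + e\<^sup>2 / (2 * e)"
    using e n by (intro add_strict_left_mono divide_strict_right_mono power_strict_mono) auto
  also have "\<dots> = e" using e by (simp add: power2_eq_square)
  finally show ?thesis .
qed

instance L2S1 :: banach
proof
  fix X :: "nat \<Rightarrow> L2S1" assume "Cauchy X"
  have "\<forall>n. \<exists>s. sq_integrable s \<and> X n = abs_L2S1 s" by (metis abs_L2S1_cases)
  then obtain s where s: "\<And>n. sq_integrable (s n)" "\<And>n. X n = abs_L2S1 (s n)" by metis
  have [measurable]: "s n \<in> borel_measurable borel" for n using s(1) by (simp add: sq_integrable_def)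
  have s_int: "integrable circle (s n)" for n
    using sq_integrable_mult[OF s(1), of "\<lambda>_. 1"] by (simp add: sq_integrable_def)
  have "\<exists>N. \<forall>i\<ge>N. \<forall>j\<ge>N. (\<integral>x. norm (s i x - s j x) \<partial>circle) < e" if e: "e > 0" for e
  proof -
    obtain N where "\<And>i j. i \<ge> N \<Longrightarrow> j \<ge> N \<Longrightarrow> norm (X i - X j) < e"
      using CauchyD[OF \<open>Cauchy X\<close> e] by auto
    then show ?thesis
      using L1_less_of_L2_less[OF sq_integrable_diff[OF s(1) s(1)] e]
      by (metis abs_L2S1_diff s)
  qed
  from cauchy_L1_AE_cauchy_subseq[OF s_int this] obtain r where
    r: "strict_mono r" "AE x in circle. Cauchy (\<lambda>i. s (r i) x)" by metis
  define f where "f x = lim (\<lambda>i. s (r i) (frac x))" for x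
  have f_meas [measurable]: "f \<in> borel_measurable borel"
    unfolding f_def by measurable
  have lim: "AE x in circle. (\<lambda>i. s (r i) x) \<longlonglongrightarrow> f x"
    using r(2) AE_space
  proof eventually_elim
    case (elim x)
    then have "frac x = x" by (simp add: frac_eq)
    then show ?case using elim(1) by (simp add: f_def convergent_LIMSEQ_iff[symmetric] Cauchy_convergent_iff)
  qed
  have key: "sq_integrable (\<lambda>x. s n x - f x) \<and> norm (abs_L2S1 (\<lambda>x. s n x - f x)) \<le> e"
    if e: "e > 0" and N: "\<And>i j. i \<ge> N \<Longrightarrow> j \<ge> N \<Longrightarrow> norm (X i - X j) < e" and n: "n \<ge> N" for n N e
  proof -
    have "(\<integral>\<^sup>+x. ennreal ((cmod (s n x - f x))\<^sup>2) \<partial>circle)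
        = (\<integral>\<^sup>+x. liminf (\<lambda>i. ennreal ((cmod (s n x - s (r i) x))\<^sup>2)) \<partial>circle)"
    proof (rule nn_integral_cong_AE)
      show "AE x in circle. ennreal ((cmod (s n x - f x))\<^sup>2) = liminf (\<lambda>i. ennreal ((cmod (s n x - s (r i) x))\<^sup>2))"
        using lim
      proof eventually_elim
        case (elim x)
        have "(\<lambda>i. ennreal ((cmod (s n x - s (r i) x))\<^sup>2)) \<longlonglongrightarrow> ennreal ((cmod (s n x - f x))\<^sup>2)"
          by (intro tendsto_intros elim)
        then show ?case by (intro lim_imp_Liminf[symmetric]) auto
      qed
    qed
    also have "\<dots> \<le> liminf (\<lambda>i. \<integral>\<^sup>+x. ennreal ((cmod (s n x - s (r i) x))\<^sup>2) \<partial>circle)"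
      by (rule nn_integral_liminf) measurable
    also have "\<dots> \<le> ennreal (e\<^sup>2)"
    proof (rule Liminf_le)
      show "\<forall>\<^sub>F i in sequentially. (\<integral>\<^sup>+x. ennreal ((cmod (s n x - s (r i) x))\<^sup>2) \<partial>circle) \<le> ennreal (e\<^sup>2)"
        using eventually_ge_at_top[of N]
      proof eventually_elim
        case (elim i)
        then have "r i \<ge> N" using seq_suble[OF r(1), of i] by simp
        then have "norm (X n - X (r i)) \<le> e" using N n by (simp add: less_imp_le)
        then have "(norm (abs_L2S1 (\<lambda>x. s n x - s (r i) x)))\<^sup>2 \<le> e\<^sup>2"
          by (intro power_mono) (auto simp: s abs_L2S1_diff)
        moreover have "sq_integrable (\<lambda>x. s n x - s (r i) x)" by (intro sq_integrable_diff s)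
        ultimately show ?case
          by (subst nn_integral_eq_integral) (auto simp: norm_abs_L2S1 sq_integrable_def intro!: ennreal_leI)
      qed
    qed simp
    finally have le: "(\<integral>\<^sup>+x. ennreal ((cmod (s n x - f x))\<^sup>2) \<partial>circle) \<le> ennreal (e\<^sup>2)" .
    have m: "(\<lambda>x. (cmod (s n x - f x))\<^sup>2) \<in> borel_measurable circle"
      by (rule measurable_circle) measurable
    have "integrable circle (\<lambda>x. (cmod (s n x - f x))\<^sup>2)"
      using le m by (intro integrableI_bounded) (auto intro: le_less_trans)
    moreover have "f (x + 1) = f x" for x by (simp add: f_def frac_1_eq)
    ultimately have sq: "sq_integrable (\<lambda>x. s n x - f x)"
      using s(1)[of n] by (auto simp: sq_integrable_def)
    have "(norm (abs_L2S1 (\<lambda>x. s n x - f x)))\<^sup>2 \<le> e\<^sup>2"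
      using le sq by (simp add: norm_abs_L2S1 sq_integrable_def nn_integral_eq_integral)
    then show ?thesis using sq e by (simp add: power2_le_iff_abs_le)
  qed
  obtain N where "\<And>i j. i \<ge> N \<Longrightarrow> j \<ge> N \<Longrightarrow> norm (X i - X j) < 1"
    using CauchyD[OF \<open>Cauchy X\<close>, of 1] by auto
  then have "sq_integrable (\<lambda>x. s N x - f x)" using key[of 1 N N] by simp
  from sq_integrable_diff[OF s(1)[of N] this] have f: "sq_integrable f" by simp
  have "X \<longlonglongrightarrow> abs_L2S1 f"
  proof (rule LIMSEQ_I)
    fix e :: real assume "e > 0"
    then obtain N where "\<And>i j. i \<ge> N \<Longrightarrow> j \<ge> N \<Longrightarrow> norm (X i - X j) < e / 2"
      using CauchyD[OF \<open>Cauchy X\<close>, of "e / 2"] by auto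
    then have "\<forall>n\<ge>N. norm (X n - abs_L2S1 f) < e"
      using key[of "e / 2" N] \<open>e > 0\<close> by (force simp: s abs_L2S1_diff f)
    then show "\<exists>N. \<forall>n\<ge>N. norm (X n - abs_L2S1 f) < e" ..
  qed
  then show "convergent X" by (rule convergentI)
qed


lemma abs_L2S1_dominated:
  assumes f: "sq_integrable f" and F: "\<And>n. sq_integrable (F n)" and w: "integrable circle (\<lambda>x. (w x)\<^sup>2)"
    and bound: "\<And>n x. 0 \<le> x \<Longrightarrow> x < 1 \<Longrightarrow> cmod (F n x) \<le> w x"
    and lim: "\<And>x. 0 \<le> x \<Longrightarrow> x < 1 \<Longrightarrow> (\<lambda>n. F n x) \<longlonglongrightarrow> f x"
  shows "(\<lambda>n. abs_L2S1 (F n)) \<longlonglongrightarrow> abs_L2S1 f"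
proof -
  have [measurable]: "f \<in> borel_measurable borel" "F n \<in> borel_measurable borel" for n
    using f F by (auto simp: sq_integrable_def)
  have "(\<lambda>n. \<integral>x. (cmod (F n x - f x))\<^sup>2 \<partial>circle) \<longlonglongrightarrow> (\<integral>x. 0 \<partial>circle)"
  proof (rule integral_dominated_convergence)
    show "integrable circle (\<lambda>x. 2 * (w x)\<^sup>2 + 2 * (cmod (f x))\<^sup>2)"
      using f w by (simp add: sq_integrable_def)
    show "(\<lambda>x. (cmod (F n x - f x))\<^sup>2) \<in> borel_measurable circle" for n
      by (rule measurable_circle) measurable
    show "AE x in circle. (\<lambda>n. (cmod (F n x - f x))\<^sup>2) \<longlonglongrightarrow> 0"
      using AE_space
    proof eventually_elim
      case (elim x)
      then have "(\<lambda>n. F n x) \<longlonglongrightarrow> f x" using lim by simp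
      then have "(\<lambda>n. (cmod (F n x - f x))\<^sup>2) \<longlonglongrightarrow> (cmod (f x - f x))\<^sup>2"
        by (intro tendsto_intros)
      then show ?case by simp
    qed
    show "AE x in circle. norm ((cmod (F n x - f x))\<^sup>2) \<le> 2 * (w x)\<^sup>2 + 2 * (cmod (f x))\<^sup>2" for n
      using AE_space
    proof eventually_elim
      case (elim x)
      then have "(cmod (F n x))\<^sup>2 \<le> (w x)\<^sup>2" using bound by (intro power_mono) auto
      then show ?case using cmod_add_sq_le[of "F n x" "- f x"] by simp
    qed
  qed simp_all
  then have "(\<lambda>n. (norm (abs_L2S1 (F n) - abs_L2S1 f))\<^sup>2) \<longlonglongrightarrow> 0"
    by (simp add: abs_L2S1_diff norm_abs_L2S1 sq_integrable_diff F f)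
  then have "(\<lambda>n. norm (abs_L2S1 (F n) - abs_L2S1 f)) \<longlonglongrightarrow> 0"
    by simp
  then show ?thesis by (simp add: tendsto_norm_zero_iff LIM_zero_iff)
qed

text \<open>
  Separability (needed for the Bochner integral of curves): the complex-rational combinations of
  indicator functions of rational half-lines are dense.
\<close>

definition ind_L2S1 :: "real set \<Rightarrow> L2S1"
  where "ind_L2S1 A = abs_L2S1 (\<lambda>x. indicator A (frac x))"

lemma sq_integrable_ind:
  assumes [measurable]: "A \<in> sets borel" shows "sq_integrable (\<lambda>x. indicator A (frac x))"
proof (rule sq_integrable_periodize)
  show "integrable circle (\<lambda>x. (cmod (indicator A x))\<^sup>2)"
    by (rule circle.integrable_const_bound[of _ 1])
      (auto simp: indicator_def intro!: measurable_circle)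
qed measurable

lemma ind_L2S1_tendsto:
  assumes [measurable]: "\<And>n. A n \<in> sets borel" "B \<in> sets borel"
    and lim: "\<And>x. \<forall>\<^sub>F n in sequentially. x \<in> A n \<longleftrightarrow> x \<in> B"
  shows "(\<lambda>n. ind_L2S1 (A n)) \<longlonglongrightarrow> ind_L2S1 B"
  unfolding ind_L2S1_def
proof (rule abs_L2S1_dominated[where w = "\<lambda>_. 1"])
  show "sq_integrable (\<lambda>x. indicator B (frac x))" "sq_integrable (\<lambda>x. indicator (A n) (frac x))" for n
    by (rule sq_integrable_ind; measurable)+
  show "(\<lambda>n. indicator (A n) (frac x) :: complex) \<longlonglongrightarrow> indicator B (frac x)" for x
    by (rule tendsto_eventually) (use lim[of "frac x"] in \<open>auto elim: eventually_mono simp: indicator_def\<close>)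
qed (auto simp: indicator_def)

definition rat_comb :: "(rat \<times> rat \<times> rat) list \<Rightarrow> L2S1"
  where "rat_comb xs = (\<Sum>(p, q, a)\<leftarrow>xs. Complex (of_rat p) (of_rat q) *\<^sub>C ind_L2S1 {..of_rat a})"

lemma norm_scaleC: "norm (c *\<^sub>C f) = cmod c * norm f"
proof -
  have "hprod (c *\<^sub>C f) (c *\<^sub>C f) = (c * cnj c) * hprod f f"
    by (simp only: hprod_scaleC_left hprod_scaleC_right mult_ac)
  also have "c * cnj c = complex_of_real ((cmod c)\<^sup>2)"
    by (rule complex_norm_square[symmetric])
  finally have "inner (c *\<^sub>C f) (c *\<^sub>C f) = (cmod c)\<^sup>2 * inner f f"
    by (simp only: inner_L2S1_def Re_complex_of_real Im_complex_of_real complex.sel times_complex.sel mult_zero_left diff_zero)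
  then have "norm (c *\<^sub>C f) = sqrt ((cmod c)\<^sup>2 * inner f f)"
    by (simp only: norm_eq_sqrt_inner)
  then show ?thesis
    by (simp only: real_sqrt_mult norm_eq_sqrt_inner[of f]) simp
qed

lemma bounded_bilinear_scaleC: "bounded_bilinear scaleC"
proof
  fix c d :: complex and f g :: L2S1 and r :: real
  show "(c + d) *\<^sub>C f = c *\<^sub>C f + d *\<^sub>C f" by (rule scaleC_add_left)
  show "c *\<^sub>C (f + g) = c *\<^sub>C f + c *\<^sub>C g" by (rule scaleC_add_right)
  show "(r *\<^sub>R c) *\<^sub>C f = r *\<^sub>R (c *\<^sub>C f)"
    by (simp only: scaleR_L2S1_def scaleC_scaleC scaleR_conv_of_real)
  show "c *\<^sub>C (r *\<^sub>R f) = r *\<^sub>R (c *\<^sub>C f)"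
    by (simp only: scaleR_L2S1_def scaleC_scaleC mult.commute)
next
  show "\<exists>K. \<forall>c f. norm (c *\<^sub>C f) \<le> norm c * norm f * K"
    by (rule exI[of _ 1]) (simp only: norm_scaleC mult_1_right order_refl simp_thms)
qed

lemma rat_approx:
  fixes r :: real
  shows "\<exists>p :: nat \<Rightarrow> rat. (\<forall>n. r < of_rat (p n)) \<and> (\<lambda>n. of_rat (p n)) \<longlonglongrightarrow> r"
proof -
  have "\<exists>p :: rat. r < of_rat p \<and> of_rat p < r + inverse (real (Suc n))" for n
    by (rule of_rat_dense) simp
  then obtain p :: "nat \<Rightarrow> rat" where
    p: "\<And>n. r < of_rat (p n)" "\<And>n. of_rat (p n) < r + inverse (real (Suc n))" by metis
  have "(\<lambda>n. r + inverse (real (Suc n))) \<longlonglongrightarrow> r + 0"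
    by (rule tendsto_add[OF tendsto_const LIMSEQ_inverse_real_of_nat])
  then have lim: "(\<lambda>n. r + inverse (real (Suc n))) \<longlonglongrightarrow> r" by (simp only: add_0_right)
  have "(\<lambda>n. of_rat (p n)) \<longlonglongrightarrow> r"
  proof (rule tendsto_sandwich[OF _ _ tendsto_const lim])
    show "\<forall>\<^sub>F n in sequentially. r \<le> of_rat (p n)"
      using p(1) by (intro always_eventually allI less_imp_le)
    show "\<forall>\<^sub>F n in sequentially. of_rat (p n) \<le> r + inverse (real (Suc n))"
      using p(2) by (intro always_eventually allI less_imp_le)
  qed
  then show ?thesis using p(1) by (intro exI[of _ p]) simp
qed

lemma Complex_rat_dense: obtains p q :: "nat \<Rightarrow> rat"
  where "(\<lambda>n. Complex (of_rat (p n)) (of_rat (q n))) \<longlonglongrightarrow> c"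
proof -
  obtain p where p: "(\<lambda>n. of_rat (p n)) \<longlonglongrightarrow> Re c" using rat_approx by blast
  obtain q where q: "(\<lambda>n. of_rat (q n)) \<longlonglongrightarrow> Im c" using rat_approx by blast
  from tendsto_Complex[OF p q] show ?thesis by (intro that) simp
qed

lemma closure_add:
  fixes S :: "'a::real_normed_vector set"
  assumes S: "\<And>x y. x \<in> S \<Longrightarrow> y \<in> S \<Longrightarrow> x + y \<in> S" and "x \<in> closure S" "y \<in> closure S"
  shows "x + y \<in> closure S"
proof -
  obtain u v where "\<And>n. u n \<in> S" "u \<longlonglongrightarrow> x" "\<And>n. v n \<in> S" "v \<longlonglongrightarrow> y"
    using assms(2,3) by (auto simp: closure_sequential)
  then show ?thesis
    unfolding closure_sequential
    by (intro exI[of _ "\<lambda>n. u n + v n"]) (auto intro: S tendsto_add)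
qed

lemma rat_comb_append: "rat_comb (xs @ ys) = rat_comb xs + rat_comb ys"
  by (simp add: rat_comb_def)

lemma rat_comb_scale:
  "\<exists>ys. Complex (of_rat p) (of_rat q) *\<^sub>C rat_comb xs = rat_comb ys"
proof (induction xs)
  case Nil
  show ?case by (rule exI[of _ "[]"]) (simp add: rat_comb_def bounded_bilinear.zero_right[OF bounded_bilinear_scaleC])
next
  case (Cons x xs)
  obtain r s a where x: "x = (r, s, a)" by (cases x)
  from Cons obtain ys where ys: "Complex (of_rat p) (of_rat q) *\<^sub>C rat_comb xs = rat_comb ys" ..
  have "Complex (of_rat p) (of_rat q) *\<^sub>C rat_comb (x # xs) = rat_comb ((p * r - q * s, p * s + q * r, a) # ys)"
  proof -
    have "Complex (of_rat p) (of_rat q) * Complex (of_rat r) (of_rat s)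
        = Complex (of_rat (p * r - q * s)) (of_rat (p * s + q * r))"
      by (simp add: complex_eq_iff of_rat_add of_rat_diff of_rat_mult)
    then show ?thesis using ys
      by (simp only: rat_comb_def x list.map sum_list.Cons prod.case scaleC_add_right scaleC_scaleC)
  qed
  then show ?case ..
qed

lemma closure_rat_comb_add:
  "x \<in> closure (range rat_comb) \<Longrightarrow> y \<in> closure (range rat_comb) \<Longrightarrow> x + y \<in> closure (range rat_comb)"
proof (rule closure_add)
  fix x y assume "x \<in> range rat_comb" "y \<in> range rat_comb"
  then obtain xs ys where "x = rat_comb xs" "y = rat_comb ys" by blast
  then have "x + y = rat_comb (xs @ ys)" by (simp only: rat_comb_append)
  then show "x + y \<in> range rat_comb" by (rule range_eqI)
qed

lemma closure_rat_comb_scale: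
  assumes "x \<in> closure (range rat_comb)" shows "c *\<^sub>C x \<in> closure (range rat_comb)"
proof -
  obtain u where u: "\<And>n. u n \<in> range rat_comb" "u \<longlonglongrightarrow> x"
    using assms unfolding closure_sequential by (elim exE conjE) (rule that, simp_all)
  obtain p q where pq: "(\<lambda>n. Complex (of_rat (p n)) (of_rat (q n))) \<longlonglongrightarrow> c"
    by (rule Complex_rat_dense)
  have "(\<lambda>n. Complex (of_rat (p n)) (of_rat (q n)) *\<^sub>C u n) \<longlonglongrightarrow> c *\<^sub>C x"
    by (rule bounded_bilinear.tendsto[OF bounded_bilinear_scaleC pq u(2)])
  moreover have "Complex (of_rat (p n)) (of_rat (q n)) *\<^sub>C u n \<in> range rat_comb" for n
  proof -
    from u(1)[of n] obtain xs where "u n = rat_comb xs" by blast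
    moreover obtain ys where "Complex (of_rat (p n)) (of_rat (q n)) *\<^sub>C rat_comb xs = rat_comb ys"
      using rat_comb_scale by blast
    ultimately show ?thesis by (simp only: rangeI)
  qed
  ultimately show ?thesis unfolding closure_sequential by (intro exI conjI allI)
qed

lemma closure_rat_comb_limit:
  assumes "\<And>n. u n \<in> closure (range rat_comb)" "u \<longlonglongrightarrow> x" shows "x \<in> closure (range rat_comb)"
  by (rule closed_sequentially[OF closed_closure assms])

lemma closure_rat_comb_zero: "0 \<in> closure (range rat_comb)"
proof -
  have "0 = rat_comb []" by (simp add: rat_comb_def)
  then have "0 \<in> range rat_comb" by (rule range_eqI)
  then show ?thesis by (rule closure_subset[THEN subsetD])
qed

lemma closure_rat_comb_ind:
  assumes "A \<in> sets borel" shows "ind_L2S1 A \<in> closure (range rat_comb)"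
proof -
  let ?C = "closure (range rat_comb)"
  have gen: "sets borel = sigma_sets UNIV (range (\<lambda>a::real. {..a}))"
    unfolding borel_eq_atMost by (rule sets_measure_of) (simp only: Pow_UNIV subset_UNIV)
  have halfline: "ind_L2S1 {..a} \<in> ?C" for a :: real
  proof -
    obtain p :: "nat \<Rightarrow> rat" where p0: "\<forall>n. a < of_rat (p n)" and p2: "(\<lambda>n. of_rat (p n)) \<longlonglongrightarrow> a"
      using rat_approx[of a] by (elim exE conjE) (rule that)
    have p1: "a < of_rat (p n)" for n using p0 by (rule spec)
    have "(\<lambda>n. ind_L2S1 {..of_rat (p n)}) \<longlonglongrightarrow> ind_L2S1 {..a}"
    proof (rule ind_L2S1_tendsto)
      fix x :: real
      show "\<forall>\<^sub>F n in sequentially. x \<in> {..of_rat (p n)} \<longleftrightarrow> x \<in> {..a}"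
      proof (cases "x \<le> a")
        case True
        have "x \<in> {..of_rat (p n)}" for n
          using less_imp_le[OF le_less_trans[OF True p1]] by (simp only: atMost_iff)
        then have "x \<in> {..of_rat (p n)} \<longleftrightarrow> x \<in> {..a}" for n
          using True by blast
        then show ?thesis by (intro always_eventually allI)
      next
        case False
        then have "\<forall>\<^sub>F n in sequentially. of_rat (p n) < x"
          by (intro order_tendstoD(2)[OF p2]) simp
        then show ?thesis
        proof eventually_elim
          case (elim n)
          then have "\<not> x \<le> of_rat (p n)" by (simp only: not_le)
          then show ?case using False by (simp only: atMost_iff)
        qed
      qed
    qed (rule borel_closed, rule closed_atMost)+
    moreover have "ind_L2S1 {..of_rat q} \<in> ?C" for q
    proof -
      have "rat_comb [(1, 0, q)] = Complex 1 0 *\<^sub>C ind_L2S1 {..of_rat q}"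
        by (simp only: rat_comb_def list.map sum_list.Cons sum_list.Nil prod.case of_rat_1 of_rat_0 add_0_right)
      then have "ind_L2S1 {..of_rat q} = rat_comb [(1, 0, q)]"
        by (simp only: one_complex.code[symmetric] scaleC_one)
      then have "ind_L2S1 {..of_rat q} \<in> range rat_comb" by (rule range_eqI)
      then show ?thesis by (rule closure_subset[THEN subsetD])
    qed
    ultimately show ?thesis
      by (intro closure_rat_comb_limit[of "\<lambda>n. ind_L2S1 {..of_rat (p n)}" "ind_L2S1 {..a}"])
  qed
  have add_ind: "ind_L2S1 (A \<union> B) = ind_L2S1 A + ind_L2S1 B"
    if "A \<inter> B = {}" "A \<in> sets borel" "B \<in> sets borel" for A B
  proof -
    have "(\<lambda>x. indicator (A \<union> B) (frac x) :: complex) = (\<lambda>x. indicator A (frac x) + indicator B (frac x))"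
      using that(1) by (auto simp: indicator_def fun_eq_iff)
    then show ?thesis
      unfolding ind_L2S1_def abs_L2S1_add[OF sq_integrable_ind[OF that(2)] sq_integrable_ind[OF that(3)]]
      by (rule arg_cong)
  qed
  have zero: "ind_L2S1 {} = 0" by (simp add: ind_L2S1_def zero_L2S1_def)
  have "Int_stable (range (\<lambda>a::real. {..a}))"
    by (auto simp: Int_stable_def)
  moreover have "range (\<lambda>a::real. {..a}) \<subseteq> Pow UNIV" by simp
  moreover have "A \<in> sigma_sets UNIV (range (\<lambda>a::real. {..a}))" using assms by (simp only: gen)
  ultimately show ?thesis
  proof (induction rule: sigma_sets_induct_disjoint)
    case (basic A)
    then show ?case using halfline by auto
  next
    case empty
    show ?case by (simp only: zero closure_rat_comb_zero)
  next
    case (compl A)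
    have A: "A \<in> sets borel" unfolding gen by (rule compl(1))
    have "(\<lambda>n. ind_L2S1 {..real n}) \<longlonglongrightarrow> ind_L2S1 UNIV"
    proof (rule ind_L2S1_tendsto)
      show "\<forall>\<^sub>F n in sequentially. x \<in> {..real n} \<longleftrightarrow> x \<in> UNIV" for x :: real
        using eventually_ge_at_top[of "nat \<lceil>x\<rceil>"] by eventually_elim (simp only: atMost_iff UNIV_I simp_thms, linarith)
    qed auto
    then have "ind_L2S1 UNIV \<in> ?C" by (rule closure_rat_comb_limit[OF halfline])
    moreover have "ind_L2S1 UNIV = ind_L2S1 (UNIV - A) + ind_L2S1 A"
      using add_ind[of "UNIV - A" A] A by (simp add: Compl_partition2 flip: Compl_eq_Diff_UNIV)
    then have "ind_L2S1 (UNIV - A) = ind_L2S1 UNIV + (- 1) *\<^sub>C ind_L2S1 A"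
      by (simp flip: uminus_L2S1_def)
    ultimately show ?case
      using closure_rat_comb_add[OF _ closure_rat_comb_scale[OF compl(2)]] by metis
  next
    case (union A)
    have A: "A i \<in> sets borel" for i unfolding gen using union(2) by blast
    have part: "ind_L2S1 (\<Union>i<n. A i) \<in> ?C" for n
    proof (induction n)
      case 0
      show ?case using closure_rat_comb_zero by (simp add: zero)
    next
      case (Suc n)
      have "ind_L2S1 (\<Union>i<Suc n. A i) = ind_L2S1 (A n) + ind_L2S1 (\<Union>i<n. A i)"
        unfolding lessThan_Suc UN_insert
      proof (rule add_ind)
        show "A n \<inter> (\<Union>i<n. A i) = {}"
          using disjoint_family_onD[OF union(1) UNIV_I UNIV_I, of n] by fastforce
      qed (use A in auto)
      then show ?case using closure_rat_comb_add[OF union(3)[of n] Suc] by metis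
    qed
    have "(\<lambda>n. ind_L2S1 (\<Union>i<n. A i)) \<longlonglongrightarrow> ind_L2S1 (\<Union>i. A i)"
    proof (rule ind_L2S1_tendsto)
      show "\<forall>\<^sub>F n in sequentially. x \<in> (\<Union>i<n. A i) \<longleftrightarrow> x \<in> (\<Union>i. A i)" for x
      proof (cases "x \<in> (\<Union>i. A i)")
        case True
        then obtain j where "x \<in> A j" by auto
        then show ?thesis
          by (intro eventually_mono[OF eventually_gt_at_top[of j]]) blast
      qed auto
    qed (use A in auto)
    then show ?case by (rule closure_rat_comb_limit[OF part])
  qed
qed

lemma closure_rat_comb: "closure (range rat_comb) = UNIV"
proof -
  let ?C = "closure (range rat_comb)"
  have "g \<in> ?C" for g
  proof -
    obtain f where f: "sq_integrable f" "g = abs_L2S1 f" by (rule abs_L2S1_cases)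
    have [measurable]: "f \<in> borel_measurable borel" using f by (simp add: sq_integrable_def)
    obtain F where F0: "\<forall>n. simple_function borel (F n)"
        "\<forall>x\<in>space borel. (\<lambda>n. F n x) \<longlonglongrightarrow> f x"
        "\<forall>n. \<forall>x\<in>space borel. dist (F n x) 0 \<le> 2 * dist (f x) 0"
      using borel_measurable_implies_sequence_metric[of f borel 0] \<open>f \<in> borel_measurable borel\<close> by metis
    then have F: "\<And>n. simple_function borel (F n)" "\<And>x. (\<lambda>n. F n x) \<longlonglongrightarrow> f x"
      "\<And>n x. dist (F n x) 0 \<le> 2 * dist (f x) 0"
      by (auto simp only: space_borel UNIV_I)
    have F_meas [measurable]: "F n \<in> borel_measurable borel" for n
      by (rule borel_measurable_simple_function[OF F(1)])
    have F_bd: "(cmod (F n x))\<^sup>2 \<le> (2 * cmod (f x))\<^sup>2" for n x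
      using F(3)[of n x] by (intro power_mono) auto
    have w: "integrable circle (\<lambda>x. (2 * cmod (f x))\<^sup>2)"
      using f by (simp add: sq_integrable_def power_mult_distrib)
    have F_sq: "sq_integrable (\<lambda>x. F n (frac x))" for n
    proof (rule sq_integrable_periodize)
      show "integrable circle (\<lambda>x. (cmod (F n x))\<^sup>2)"
      proof (rule Bochner_Integration.integrable_bound[OF w])
        show "(\<lambda>x. (cmod (F n x))\<^sup>2) \<in> borel_measurable circle"
          by (rule measurable_circle) measurable
      qed (use F_bd in simp)
    qed measurable
    have "abs_L2S1 (\<lambda>x. F n (frac x)) \<in> ?C" for n
    proof -
      let ?S = "range (F n)"
      have fin: "finite ?S" using simple_functionD(1)[OF F(1)[of n]] by simp
      have "sq_integrable (\<lambda>x. \<Sum>y\<in>T. y * indicator (F n -` {y}) (frac x))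
          \<and> abs_L2S1 (\<lambda>x. \<Sum>y\<in>T. y * indicator (F n -` {y}) (frac x)) \<in> ?C" if "finite T" for T
        using that
      proof (induction T rule: finite_induct)
        case empty
        show ?case using closure_rat_comb_zero by (simp add: zero_L2S1_def sq_integrable_zero)
      next
        case (insert y T)
        have m: "F n -` {y} \<in> sets borel"
          using measurable_sets[OF F_meas, of "{y}"] by simp
        have sq: "sq_integrable (\<lambda>x. y * indicator (F n -` {y}) (frac x))"
          by (intro sq_integrable_scale sq_integrable_ind m)
        have cl: "abs_L2S1 (\<lambda>x. y * indicator (F n -` {y}) (frac x)) \<in> ?C"
          using closure_rat_comb_scale[OF closure_rat_comb_ind[OF m], of y]
          unfolding ind_L2S1_def abs_L2S1_scaleC[OF sq_integrable_ind[OF m]] .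
        from insert(3) have IH:
          "sq_integrable (\<lambda>x. \<Sum>y\<in>T. y * indicator (F n -` {y}) (frac x))"
          "abs_L2S1 (\<lambda>x. \<Sum>y\<in>T. y * indicator (F n -` {y}) (frac x)) \<in> ?C" by (rule conjunct1, rule conjunct2)
        show ?case
          unfolding sum.insert[OF insert(1,2)]
          using sq_integrable_add[OF sq IH(1)] closure_rat_comb_add[OF cl IH(2)]
          unfolding abs_L2S1_add[OF sq IH(1)] by (rule conjI)
      qed
      note T = this
      have "(\<Sum>y\<in>?S. y * indicator (F n -` {y}) x) = F n x" for x
      proof -
        have "(\<Sum>y\<in>?S. y * indicator (F n -` {y}) x) = (\<Sum>y\<in>?S. if y = F n x then y else 0)"
          by (rule sum.cong) (auto simp: indicator_def)
        then show ?thesis using fin by simp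
      qed
      with T[OF fin] show ?thesis by simp
    qed
    moreover have "(\<lambda>n. abs_L2S1 (\<lambda>x. F n (frac x))) \<longlonglongrightarrow> g"
      unfolding f(2)
    proof (rule abs_L2S1_dominated[OF f(1) F_sq w])
      show "(\<lambda>n. F n (frac x)) \<longlonglongrightarrow> f x" "cmod (F n (frac x)) \<le> 2 * cmod (f x)"
        if "0 \<le> x" "x < 1" for n x
      proof -
        have "frac x = x" using that by (simp add: frac_eq)
        then show "(\<lambda>n. F n (frac x)) \<longlonglongrightarrow> f x" "cmod (F n (frac x)) \<le> 2 * cmod (f x)"
          using F(2)[of x] F(3)[of n x] by auto
      qed
    qed
    ultimately show ?thesis by (rule closure_rat_comb_limit)
  qed
  then show ?thesis by auto
qed

instance L2S1 :: second_countable_topology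
proof
  let ?B = "(\<lambda>(xs, n). ball (rat_comb xs) (inverse (real (Suc n)))) ` UNIV"
  have "topological_basis ?B"
  proof (rule topological_basisI)
    fix U :: "L2S1 set" and f assume U: "open U" "f \<in> U"
    then obtain e where e: "e > 0" "ball f e \<subseteq> U" by (auto simp: open_contains_ball)
    obtain n where n: "inverse (real (Suc n)) < e / 2" using reals_Archimedean[of "e / 2"] e by auto
    have "f \<in> closure (range rat_comb)" by (simp add: closure_rat_comb)
    moreover have "0 < inverse (real (Suc n))" by simp
    ultimately obtain xs where xs: "dist (rat_comb xs) f < inverse (real (Suc n))"
      unfolding closure_approachable by blast
    have "ball (rat_comb xs) (inverse (real (Suc n))) \<subseteq> ball f e"
    proof
      fix h assume "h \<in> ball (rat_comb xs) (inverse (real (Suc n)))"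
      then have "dist (rat_comb xs) h < e / 2" "dist f (rat_comb xs) < e / 2"
        using n xs by (auto simp: dist_commute)
      then show "h \<in> ball f e" using dist_triangle[of f h "rat_comb xs"] by simp
    qed
    then have "f \<in> ball (rat_comb xs) (inverse (real (Suc n))) \<and> ball (rat_comb xs) (inverse (real (Suc n))) \<subseteq> U"
      using xs e(2) by auto
    then show "\<exists>B'\<in>?B. f \<in> B' \<and> B' \<subseteq> U"
      by (intro bexI[OF _ image_eqI[of _ _ "(xs, n)"]]) simp_all
  qed auto
  moreover have "countable ?B" by (rule countable_image) simp
  ultimately show "\<exists>B :: L2S1 set set. countable B \<and> open = generate_topology B"
    using topological_basis_imp_subbasis by blast
qed


section \<open>Submanifolds of a Hilbert space with the induced metric\<close>

text \<open>
  A submanifold of a real inner product space is given by its carrier M and its tangent spaces T q,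
  as linear subspaces of the ambient space; its metric is the restriction of the ambient one.
\<close>

definition orth_proj :: "'a::real_inner set \<Rightarrow> 'a \<Rightarrow> 'a"
  where "orth_proj V w = (THE u. u \<in> V \<and> (\<forall>v\<in>V. inner (w - u) v = 0))"

text \<open>
  The Levi-Civita connection of the induced metric is the tangential part of the ambient derivative
  (Gauss formula); below it is checked to be metric and torsion free on the sphere.
\<close>

definition levi_civita :: "('a::real_inner \<Rightarrow> 'a set) \<Rightarrow> 'a \<Rightarrow> ('a \<Rightarrow> 'a) \<Rightarrow> 'a \<Rightarrow> 'a"
  where "levi_civita T v Y q = orth_proj (T q) (frechet_derivative Y (at q) v)"

definition velocity :: "(real \<Rightarrow> 'a::real_normed_vector) \<Rightarrow> real \<Rightarrow> 'a"
  where "velocity \<gamma> t = vector_derivative \<gamma> (at t)"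

text \<open>The associated covariant derivative of a vector field V along a curve.\<close>

definition covariant_derivative ::
    "('a::real_inner \<Rightarrow> 'a set) \<Rightarrow> (real \<Rightarrow> 'a) \<Rightarrow> (real \<Rightarrow> 'a) \<Rightarrow> real \<Rightarrow> 'a"
  where "covariant_derivative T \<gamma> V t = orth_proj (T (\<gamma> t)) (vector_derivative V (at t))"

text \<open>
  A one-form is given by an extension to the ambient space. The exterior derivative commutes with
  restriction, so the one on the submanifold is the ambient one evaluated at tangent vectors
  (in the formula u and v are constant vector fields, so no bracket term occurs).
\<close>

definition ext_deriv :: "('a::real_normed_vector \<Rightarrow> 'a \<Rightarrow> real) \<Rightarrow> 'a \<Rightarrow> 'a \<Rightarrow> 'a \<Rightarrow> real"
  where "ext_deriv a q u v =
    frechet_derivative (\<lambda>p. a p v) (at q) u - frechet_derivative (\<lambda>p. a p u) (at q) v"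

definition oneform_norm :: "'a::real_normed_vector set \<Rightarrow> ('a \<Rightarrow> 'a set) \<Rightarrow> ('a \<Rightarrow> 'a \<Rightarrow> real) \<Rightarrow> real"
  where "oneform_norm M T a = (SUP q\<in>M. SUP v\<in>T q. \<bar>a q v\<bar> / norm v)"

definition lorentz_force :: "('a::real_inner \<Rightarrow> 'a set) \<Rightarrow> ('a \<Rightarrow> 'a \<Rightarrow> 'a \<Rightarrow> real) \<Rightarrow> 'a \<Rightarrow> 'a \<Rightarrow> 'a"
  where "lorentz_force T \<sigma> q u = (THE w. w \<in> T q \<and> (\<forall>v\<in>T q. inner w v = \<sigma> q u v))"

definition magnetic_geodesic ::
    "'a::real_inner set \<Rightarrow> ('a \<Rightarrow> 'a set) \<Rightarrow> ('a \<Rightarrow> 'a \<Rightarrow> 'a \<Rightarrow> real) \<Rightarrow> (real \<Rightarrow> 'a) \<Rightarrow> bool"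
  where "magnetic_geodesic M T \<sigma> \<gamma> \<longleftrightarrow>
    (\<forall>t. \<gamma> t \<in> M) \<and>
    (\<forall>t. \<gamma> differentiable at t) \<and>
    (\<forall>t. velocity \<gamma> differentiable at t) \<and>
    (\<forall>t. covariant_derivative T \<gamma> (velocity \<gamma>) t = lorentz_force T \<sigma> (\<gamma> t) (velocity \<gamma> t))"

definition magnetic_geodesics ::
    "'a::real_inner set \<Rightarrow> ('a \<Rightarrow> 'a set) \<Rightarrow> ('a \<Rightarrow> 'a \<Rightarrow> 'a \<Rightarrow> real) \<Rightarrow> real \<Rightarrow> 'a \<Rightarrow> 'a \<Rightarrow> (real \<Rightarrow> 'a) set"
  where "magnetic_geodesics M T \<sigma> k q\<^sub>0 q\<^sub>1 =
    {\<gamma>. magnetic_geodesic M T \<sigma> \<gamma> \<and> (\<forall>t. (norm (velocity \<gamma> t))\<^sup>2 / 2 = k) \<and>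
      q\<^sub>0 \<in> range \<gamma> \<and> q\<^sub>1 \<in> range \<gamma>}"

text \<open>
  \<open>H1_curve T M \<gamma> \<gamma>'\<close>: on the interval from 0 to T the curve \<open>\<gamma>\<close> is of class H1 with values in M,
  and \<open>\<gamma>'\<close> is its weak derivative (unique up to null sets).
\<close>

definition H1_curve ::
    "real \<Rightarrow> 'a::{real_inner, banach, second_countable_topology} set \<Rightarrow> (real \<Rightarrow> 'a) \<Rightarrow> (real \<Rightarrow> 'a) \<Rightarrow> bool"
  where "H1_curve T M \<gamma> \<gamma>' \<longleftrightarrow>
    (\<forall>t\<in>{0..T}. \<gamma> t \<in> M) \<and>
    \<gamma>' \<in> borel_measurable (lebesgue_on {0..T}) \<and>
    integrable (lebesgue_on {0..T}) (\<lambda>t. (norm (\<gamma>' t))\<^sup>2) \<and>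
    (\<forall>t\<in>{0..T}. \<gamma> t = \<gamma> 0 + (\<integral>s. \<gamma>' s \<partial>lebesgue_on {0..t}))"

definition magnetic_lagrangian :: "('a::real_inner \<Rightarrow> 'a \<Rightarrow> real) \<Rightarrow> 'a \<Rightarrow> 'a \<Rightarrow> real"
  where "magnetic_lagrangian a q v = (norm v)\<^sup>2 / 2 - a q v"

definition action :: "('a \<Rightarrow> 'a \<Rightarrow> real) \<Rightarrow> real \<Rightarrow> real \<Rightarrow> (real \<Rightarrow> 'a) \<Rightarrow> (real \<Rightarrow> 'a) \<Rightarrow> real"
  where "action L k T \<gamma> \<gamma>' = (\<integral>t. L (\<gamma> t) (\<gamma>' t) + k \<partial>lebesgue_on {0..T})"

definition mane_critical_value ::
    "'a::{real_inner, banach, second_countable_topology} set \<Rightarrow> ('a \<Rightarrow> 'a \<Rightarrow> real) \<Rightarrow> real"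
  where "mane_critical_value M a =
    Inf {k. \<forall>T>0. \<forall>\<gamma> \<gamma>'. H1_curve T M \<gamma> \<gamma>' \<longrightarrow> \<gamma> 0 = \<gamma> T \<longrightarrow>
      action (magnetic_lagrangian a) k T \<gamma> \<gamma>' \<ge> 0}"

section \<open>The magnetic system on the unit sphere\<close>

abbreviation L2_sphere :: "L2S1 set"
  where "L2_sphere \<equiv> sphere 0 1"

definition sphere_tangent :: "L2S1 \<Rightarrow> L2S1 set"
  where "sphere_tangent f = {F. Re (hprod f F) = 0}"

definition alpha :: "L2S1 \<Rightarrow> L2S1 \<Rightarrow> real"
  where "alpha f F = Re (hprod (\<i> *\<^sub>C f) F) / 2"

definition sphere_geodesics :: "real \<Rightarrow> L2S1 \<Rightarrow> L2S1 \<Rightarrow> (real \<Rightarrow> L2S1) set"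
  where "sphere_geodesics = magnetic_geodesics L2_sphere sphere_tangent (ext_deriv alpha)"

subsection \<open>Consistency checks\<close>

lemma sphere_tangent_eq: "sphere_tangent q = {v. inner q v = 0}"
  by (simp add: sphere_tangent_def inner_L2S1_def)

lemma orth_proj_sphere:
  assumes "q \<in> L2_sphere" shows "orth_proj (sphere_tangent q) w = w - inner q w *\<^sub>R q"
  unfolding orth_proj_def sphere_tangent_eq
proof (rule the_equality)
  have qq: "inner q q = 1" using assms by (simp add: norm_eq_1)
  show "w - inner q w *\<^sub>R q \<in> {v. inner q v = 0} \<and>
      (\<forall>v\<in>{v. inner q v = 0}. inner (w - (w - inner q w *\<^sub>R q)) v = 0)"
    by (simp add: inner_diff_right qq)
  fix u assume u: "u \<in> {v. inner q v = 0} \<and> (\<forall>v\<in>{v. inner q v = 0}. inner (w - u) v = 0)"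
  define d where "d = w - inner q w *\<^sub>R q - u"
  have "inner q d = 0" using u by (simp add: d_def inner_diff_right qq)
  then have "inner (w - u) d = 0" "inner q d = 0" using u by auto
  moreover have "inner d d = inner (w - u - inner q w *\<^sub>R q) d" by (simp add: d_def algebra_simps)
  ultimately have "inner d d = 0" by (simp only: inner_diff_left[of "w - u"] inner_scaleR_left mult_zero_right diff_zero)
  then show "u = w - inner q w *\<^sub>R q" by (simp add: d_def)
qed

lemma inner_derivative_sphere:
  assumes q: "q \<in> L2_sphere" and x: "x \<in> sphere_tangent q"
    and f: "(f has_derivative f') (at q)" and g: "(g has_derivative g') (at q)"
    and c: "\<And>p. p \<in> L2_sphere \<Longrightarrow> inner (f p) (g p) = c"
  shows "inner (f' x) (g q) + inner (f q) (g' x) = 0"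
proof (cases "x = 0")
  case True
  have "f' 0 = 0" "g' 0 = 0"
    using has_derivative_bounded_linear[OF f] has_derivative_bounded_linear[OF g]
    by (simp_all add: linear_simps)
  then show ?thesis using True by simp
next
  case False
  define r where "r = norm x"
  have r: "r \<noteq> 0" using False by (simp add: r_def)
  have qq: "inner q q = 1" and qx: "inner q x = 0" "inner x q = 0" and xx: "inner x x = r\<^sup>2"
    using q x by (simp_all add: norm_eq_1 sphere_tangent_eq inner_commute r_def power2_norm_eq_inner)
  define \<gamma> where "\<gamma> t = cos (r * t) *\<^sub>R q + (sin (r * t) / r) *\<^sub>R x" for t
  have "inner (\<gamma> t) (\<gamma> t) = (cos (r * t))\<^sup>2 + (sin (r * t))\<^sup>2" for t
    using r by (simp add: \<gamma>_def inner_add_left inner_add_right qq qx xx power2_eq_square)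
  then have sph: "\<gamma> t \<in> L2_sphere" for t by (simp add: norm_eq_1)
  have d: "(\<gamma> has_derivative (\<lambda>h. h *\<^sub>R x)) (at 0)"
    unfolding \<gamma>_def using r by (auto intro!: derivative_eq_intros simp: fun_eq_iff)
  have g0: "\<gamma> 0 = q" by (simp add: \<gamma>_def)
  have f1: "((\<lambda>t. f (\<gamma> t)) has_derivative (\<lambda>h. f' (h *\<^sub>R x))) (at 0)"
    using has_derivative_compose[OF d, of f f'] f by (simp add: g0)
  have g1: "((\<lambda>t. g (\<gamma> t)) has_derivative (\<lambda>h. g' (h *\<^sub>R x))) (at 0)"
    using has_derivative_compose[OF d, of g g'] g by (simp add: g0)
  have "((\<lambda>t. inner (f (\<gamma> t)) (g (\<gamma> t))) has_derivative
      (\<lambda>h. inner (f (\<gamma> 0)) (g' (h *\<^sub>R x)) + inner (f' (h *\<^sub>R x)) (g (\<gamma> 0)))) (at 0)"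
    by (rule has_derivative_inner[OF f1 g1])
  moreover have "((\<lambda>t. inner (f (\<gamma> t)) (g (\<gamma> t))) has_derivative (\<lambda>h. 0)) (at 0)"
    by (simp add: c[OF sph])
  ultimately have "(\<lambda>h. inner (f (\<gamma> 0)) (g' (h *\<^sub>R x)) + inner (f' (h *\<^sub>R x)) (g (\<gamma> 0))) = (\<lambda>h. 0)"
    by (rule has_derivative_unique)
  from fun_cong[OF this, of 1] show ?thesis by (simp add: g0 add.commute)
qed

lemma levi_civita_metric:
  assumes q: "q \<in> L2_sphere" and Y: "Y differentiable at q" "Y q \<in> sphere_tangent q"
    and Z: "Z differentiable at q" "Z q \<in> sphere_tangent q"
  shows "frechet_derivative (\<lambda>p. inner (Y p) (Z p)) (at q) v
    = inner (levi_civita sphere_tangent v Y q) (Z q) + inner (Y q) (levi_civita sphere_tangent v Z q)"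
proof -
  have "((\<lambda>p. inner (Y p) (Z p)) has_derivative
      (\<lambda>h. inner (Y q) (frechet_derivative Z (at q) h) + inner (frechet_derivative Y (at q) h) (Z q))) (at q)"
    using Y(1) Z(1) by (intro has_derivative_inner) (simp_all flip: frechet_derivative_works)
  moreover have "inner q (Z q) = 0" "inner (Y q) q = 0"
    using Y(2) Z(2) by (simp_all add: sphere_tangent_eq inner_commute)
  ultimately show ?thesis
    by (simp add: levi_civita_def orth_proj_sphere[OF q] inner_diff_left inner_diff_right
        flip: frechet_derivative_at)
qed

lemma levi_civita_torsion_free:
  assumes q: "q \<in> L2_sphere" and "X differentiable at q" "Y differentiable at q"
    and tangent: "\<And>p. p \<in> L2_sphere \<Longrightarrow> X p \<in> sphere_tangent p \<and> Y p \<in> sphere_tangent p"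
  shows "levi_civita sphere_tangent (X q) Y q - levi_civita sphere_tangent (Y q) X q
    = frechet_derivative Y (at q) (X q) - frechet_derivative X (at q) (Y q)"
proof -
  have X: "(X has_derivative frechet_derivative X (at q)) (at q)"
    and Y: "(Y has_derivative frechet_derivative Y (at q)) (at q)"
    using assms(2,3) by (simp_all flip: frechet_derivative_works)
  have "inner (X q) (Y q) + inner q (frechet_derivative Y (at q) (X q)) = 0"
    by (rule inner_derivative_sphere[OF q _ has_derivative_ident Y, where c = 0])
      (use tangent q in \<open>auto simp: sphere_tangent_eq\<close>)
  moreover have "inner (Y q) (X q) + inner q (frechet_derivative X (at q) (Y q)) = 0"
    by (rule inner_derivative_sphere[OF q _ has_derivative_ident X, where c = 0])
      (use tangent q in \<open>auto simp: sphere_tangent_eq\<close>)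
  ultimately have "inner q (frechet_derivative Y (at q) (X q)) = inner q (frechet_derivative X (at q) (Y q))"
    using inner_commute[of "X q" "Y q"] by linarith
  then show ?thesis by (simp add: levi_civita_def orth_proj_sphere[OF q])
qed

lemma covariant_derivative_levi_civita:
  assumes "\<gamma> differentiable at t" "Y differentiable at (\<gamma> t)"
  shows "covariant_derivative T \<gamma> (\<lambda>s. Y (\<gamma> s)) t = levi_civita T (velocity \<gamma> t) Y (\<gamma> t)"
proof -
  have "(\<gamma> has_vector_derivative velocity \<gamma> t) (at t)"
    using assms(1) by (simp add: velocity_def vector_derivative_works)
  moreover have Y: "(Y has_derivative frechet_derivative Y (at (\<gamma> t))) (at (\<gamma> t))"
    using assms(2) by (simp flip: frechet_derivative_works)
  ultimately have "((\<lambda>s. Y (\<gamma> s)) has_derivative (\<lambda>h. frechet_derivative Y (at (\<gamma> t)) (h *\<^sub>R velocity \<gamma> t))) (at t)"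
    unfolding has_vector_derivative_def by (rule has_derivative_compose)
  then have "((\<lambda>s. Y (\<gamma> s)) has_vector_derivative frechet_derivative Y (at (\<gamma> t)) (velocity \<gamma> t)) (at t)"
    using has_derivative_bounded_linear[OF Y]
    by (simp add: has_vector_derivative_def linear_simps)
  then show ?thesis
    by (simp add: covariant_derivative_def levi_civita_def vector_derivative_at)
qed

lemma ext_deriv_alpha: "ext_deriv alpha q u v = Re (hprod (\<i> *\<^sub>C u) v)"
proof -
  have *: "frechet_derivative (\<lambda>p. alpha p w) (at q) = (\<lambda>p. alpha p w)" for w
  proof (rule frechet_derivative_at[symmetric], rule bounded_linear_imp_has_derivative)
    have "bounded_linear (\<lambda>p. inner (\<i> *\<^sub>C p) w / 2)"
      by (intro bounded_linear_divide[THEN bounded_linear_compose] bounded_linear_inner_left[THEN bounded_linear_compose]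
          bounded_bilinear.bounded_linear_right[OF bounded_bilinear_scaleC])
    then show "bounded_linear (\<lambda>p. alpha p w)" by (simp add: alpha_def inner_L2S1_def)
  qed
  have "hprod (\<i> *\<^sub>C v) u = - cnj (hprod (\<i> *\<^sub>C u) v)"
    by (simp add: hprod_scaleC_left hprod_cnj)
  then show ?thesis unfolding ext_deriv_def * by (simp add: alpha_def)
qed

lemma lorentz_force_alpha:
  assumes "q \<in> L2_sphere"
  shows "lorentz_force sphere_tangent (ext_deriv alpha) q u = orth_proj (sphere_tangent q) (\<i> *\<^sub>C u)"
proof -
  have "(\<forall>v\<in>V. inner w v = inner (\<i> *\<^sub>C u) v) \<longleftrightarrow> (\<forall>v\<in>V. inner (\<i> *\<^sub>C u - w) v = 0)" for w V
    by (auto simp: inner_diff_left)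
  then show ?thesis
    by (simp add: lorentz_force_def orth_proj_def ext_deriv_alpha flip: inner_L2S1_def)
qed

end

theory Submission
  imports Defs
begin

text \<open>
  Along a magnetic geodesic \<open>\<gamma>\<close> the product of \<open>\<i> *\<^sub>C \<gamma>\<close> with the velocity is constant, so the geodesic
  equation is linear, and \<open>cis (- t / 2) *\<^sub>C \<gamma> t\<close> runs along a great circle of the real sphere with some
  speed \<open>\<omega>\<close>. If this great circle starts at p in direction w and \<open>hprod w p = \<i> * c\<close>, then the energy k
  satisfies \<open>2 * k = 1 / 4 + \<omega>\<^sup>2 + \<omega> * c\<close>, and the product of the points at times t and 0 is
  \<open>cis (t / 2) * Complex (cos (\<omega> * t)) (c * sin (\<omega> * t))\<close>. Hence q0 and q1 are connected precisely when
  their product is of this form for some t, \<open>\<omega>\<close> and c. As a quadratic equation for \<open>\<omega>\<close>, the energy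
  equation forces \<open>1 - 8 * k \<le> c\<^sup>2\<close>, and the modulus of the product is at least that of c.

  The bound 1 / 8 for Mane's critical value is \<open>(norm v - 1 / 2)\<^sup>2 \<ge> 0\<close>; it is attained by
  the loop \<open>cis (t / 2) *\<^sub>C q\<close>, which has speed 1 / 2.
\<close>

section \<open>Calculus with complex scalars and the Hermitian product\<close>

lemmas has_vector_derivative_scaleC = bounded_bilinear.has_vector_derivative[OF bounded_bilinear_scaleC]

lemma inner_scaleC_i_commute: "inner (\<i> *\<^sub>C f) g = - inner f (\<i> *\<^sub>C g)"
  by (simp add: inner_L2S1_def hprod_scaleC_left hprod_scaleC_right)

lemma inner_scaleC_i_i [simp]: "inner (\<i> *\<^sub>C f) (\<i> *\<^sub>C g) = inner f g"
  by (simp add: inner_L2S1_def hprod_scaleC_left hprod_scaleC_right)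

lemma inner_scaleC_i_self [simp]: "inner (\<i> *\<^sub>C f) f = 0" "inner f (\<i> *\<^sub>C f) = 0"
  using inner_scaleC_i_commute[of f f] by (simp_all add: inner_commute)

lemma hprod_eq_inner: "hprod f g = Complex (inner f g) (- inner (\<i> *\<^sub>C f) g)"
  by (simp add: inner_L2S1_def hprod_scaleC_left complex_eq_iff)

lemma hprod_add_right: "hprod f (g + h) = hprod f g + hprod f h"
  by (metis hprod_add_left hprod_cnj complex_cnj_add)

lemma hprod_self_sphere: "f \<in> L2_sphere \<Longrightarrow> hprod f f = 1"
  by (simp add: hprod_eq_inner norm_eq_1 one_complex.code)

text \<open>Testing against every \<open>g\<close> turns a vector identity with complex coefficients
  into a scalar one, where field simplification applies.\<close>

lemma L2S1_eqI: "(\<And>g. hprod f g = hprod f' g) \<Longrightarrow> f = f'"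
  by (rule vector_eq_rdot[THEN iffD1]) (simp add: inner_L2S1_def)

text \<open>Rotating \<open>g\<close> by the phase \<open>sgn h\<close> of the product makes the
  product real and nonnegative, so the real Cauchy-Schwarz inequality applies.\<close>

lemma norm_hprod_le: "cmod (hprod f g) \<le> norm f * norm g"
proof (cases "hprod f g = 0")
  case False
  define h where "h = hprod f g"
  have "cnj (sgn h) * h = (h * cnj h) / of_real (cmod h)" by (simp add: sgn_eq)
  also have "h * cnj h = of_real ((cmod h)\<^sup>2)" by (rule complex_norm_square[symmetric])
  also have "\<dots> / of_real (cmod h) = of_real (cmod h)"
    using False by (simp add: h_def power2_eq_square)
  finally have "cmod h = inner f (sgn h *\<^sub>C g)"
    by (simp add: inner_L2S1_def hprod_scaleC_right h_def)
  also have "\<dots> \<le> norm f * norm (sgn h *\<^sub>C g)" by (rule norm_cauchy_schwarz)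
  also have "norm (sgn h *\<^sub>C g) = norm g" using False by (simp add: h_def norm_scaleC norm_sgn)
  finally show ?thesis by (simp add: h_def)
qed simp

lemma bounded_bilinear_hprod: "bounded_bilinear hprod"
proof
  fix f f' g g' :: L2S1 and r :: real
  show "hprod (f + f') g = hprod f g + hprod f' g" by (rule hprod_add_left)
  show "hprod f (g + g') = hprod f g + hprod f g'" by (rule hprod_add_right)
  show "hprod (r *\<^sub>R f) g = r *\<^sub>R hprod f g" "hprod f (r *\<^sub>R g) = r *\<^sub>R hprod f g"
    by (simp_all add: scaleR_L2S1_def hprod_scaleC_left hprod_scaleC_right scaleR_conv_of_real)
  show "\<exists>K. \<forall>f g. norm (hprod f g) \<le> norm f * norm g * K"
    by (rule exI[of _ 1]) (simp add: norm_hprod_le)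
qed

interpretation hprod: bounded_bilinear hprod by (rule bounded_bilinear_hprod)
interpretation scaleC: bounded_bilinear scaleC by (rule bounded_bilinear_scaleC)

lemma has_vector_derivative_cis [derivative_intros]:
  assumes "(f has_real_derivative f') (at x within S)"
  shows "((\<lambda>x. cis (f x)) has_vector_derivative f' *\<^sub>R (\<i> * cis (f x))) (at x within S)"
proof -
  have "(cis has_vector_derivative \<i> * cis (f x)) (at (f x) within f ` S)"
    unfolding cis_conv_exp
    by (rule has_vector_derivative_real_field[of "\<lambda>z. exp (\<i> * z)"]) (auto intro!: derivative_eq_intros)
  from vector_diff_chain_within[OF assms[unfolded has_real_derivative_iff_has_vector_derivative] this]
  show ?thesis by (simp add: o_def)
qed

lemma has_vector_derivative_zero_constant:
  fixes f :: "real \<Rightarrow> 'a::real_normed_vector"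
  assumes "\<And>t. (f has_vector_derivative 0) (at t)"
  shows "f s = f t"
proof -
  obtain c where "\<And>x. f x = c"
    using has_derivative_zero_constant[of UNIV f] assms
    by (auto simp: has_vector_derivative_def)
  then show ?thesis by simp
qed

section \<open>The geodesic equation and the product of two points on a geodesic\<close>

lemma orth_proj_eq_lorentz_force_iff:
  assumes "q \<in> L2_sphere"
  shows "orth_proj (sphere_tangent q) a = lorentz_force sphere_tangent (ext_deriv alpha) q v \<longleftrightarrow>
    a - inner q a *\<^sub>R q = \<i> *\<^sub>C v - inner q (\<i> *\<^sub>C v) *\<^sub>R q"
  by (simp add: lorentz_force_alpha[OF assms] orth_proj_sphere[OF assms])

text \<open>Pairing the curve with the fixed vector \<open>q\<^sub>1\<close> turns the geodesic
  equation into a linear system for two complex functions, which is solved explicitly. For nonzero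
  \<open>\<omega>\<close> the parameter \<open>c\<close> is the cosine of the angle between
  \<open>\<i> *\<^sub>C \<gamma> t\<close> and the velocity in the rotating frame, hence its
  bound.\<close>

lemma sphere_geodesic_hprod:
  assumes \<gamma>: "\<gamma> \<in> sphere_geodesics k q\<^sub>0 q\<^sub>1"
  obtains t \<omega> c where "\<bar>c\<bar> \<le> 1" "2 * k = 1 / 4 + \<omega>\<^sup>2 + \<omega> * c"
    "hprod q\<^sub>0 q\<^sub>1 = cis (t / 2) * Complex (cos (\<omega> * t)) (c * sin (\<omega> * t))"
proof -
  define v where "v = velocity \<gamma>"
  define a where "a t = vector_derivative v (at t)" for t
  have sph: "\<gamma> t \<in> L2_sphere" and dg: "\<gamma> differentiable at t" and dv: "v differentiable at t"
    and eq: "orth_proj (sphere_tangent (\<gamma> t)) (a t) =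
        lorentz_force sphere_tangent (ext_deriv alpha) (\<gamma> t) (v t)"
    and energy: "inner (v t) (v t) = 2 * k" for t
    using \<gamma> by (auto simp: sphere_geodesics_def magnetic_geodesics_def magnetic_geodesic_def
        covariant_derivative_def v_def a_def simp flip: power2_norm_eq_inner)
  obtain t\<^sub>0 t\<^sub>1 where t: "q\<^sub>0 = \<gamma> t\<^sub>0" "q\<^sub>1 = \<gamma> t\<^sub>1"
    using \<gamma> by (auto simp: sphere_geodesics_def magnetic_geodesics_def)
  have g': "(\<gamma> has_vector_derivative v t) (at t)" for t
    using dg by (simp add: v_def velocity_def vector_derivative_works)
  have v': "(v has_vector_derivative a t) (at t)" for t
    using dv by (simp add: a_def vector_derivative_works)
  have n: "inner (\<gamma> t) (\<gamma> t) = 1" for t using sph[of t] by (simp add: norm_eq_1)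
  have orth: "inner (\<gamma> t) (v t) = 0" for t
  proof -
    have "((\<lambda>t. inner (\<gamma> t) (\<gamma> t)) has_vector_derivative inner (\<gamma> t) (v t) + inner (v t) (\<gamma> t)) (at t)"
      by (rule bounded_bilinear.has_vector_derivative[OF bounded_bilinear_inner g' g'])
    moreover have "((\<lambda>t. inner (\<gamma> t) (\<gamma> t)) has_vector_derivative 0) (at t)" by (simp add: n)
    ultimately have "inner (\<gamma> t) (v t) + inner (v t) (\<gamma> t) = 0" by (rule vector_derivative_unique_at)
    then show ?thesis by (simp add: inner_commute)
  qed
  have acc: "inner (\<gamma> t) (a t) = - 2 * k" for t
  proof -
    have "((\<lambda>t. inner (\<gamma> t) (v t)) has_vector_derivative inner (\<gamma> t) (a t) + inner (v t) (v t)) (at t)"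
      by (rule bounded_bilinear.has_vector_derivative[OF bounded_bilinear_inner g' v'])
    moreover have "((\<lambda>t. inner (\<gamma> t) (v t)) has_vector_derivative 0) (at t)" by (simp add: orth)
    ultimately have "inner (\<gamma> t) (a t) + inner (v t) (v t) = 0" by (rule vector_derivative_unique_at)
    then show ?thesis by (simp add: energy)
  qed
  define D where "D = inner (\<i> *\<^sub>C \<gamma> 0) (v 0)"
  \<comment> \<open>The geodesic equation fixes the tangential part of the acceleration; its radial
    part is \<open>acc\<close>.\<close>
  have a: "a t = \<i> *\<^sub>C v t - (2 * k - inner (\<i> *\<^sub>C \<gamma> t) (v t)) *\<^sub>R \<gamma> t" for t
    using eq[of t] unfolding orth_proj_eq_lorentz_force_iff[OF sph] acc inner_scaleC_i_commute
    by (simp add: algebra_simps)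
  \<comment> \<open>In the derivative, \<open>\<i> *\<^sub>C v t\<close> is orthogonal to
    \<open>v t\<close>, and \<open>\<i> *\<^sub>C \<gamma> t\<close> sees only the term
    \<open>\<i> *\<^sub>C v t\<close> of the acceleration, which contributes the product of
    \<open>\<gamma> t\<close> and \<open>v t\<close>, that is 0.\<close>
  have D: "inner (\<i> *\<^sub>C \<gamma> t) (v t) = D" for t
    unfolding D_def
  proof (rule has_vector_derivative_zero_constant[of "\<lambda>t. inner (\<i> *\<^sub>C \<gamma> t) (v t)"])
    fix t
    have "((\<lambda>t. inner (\<i> *\<^sub>C \<gamma> t) (v t)) has_vector_derivative
        inner (\<i> *\<^sub>C \<gamma> t) (a t) + inner (\<i> *\<^sub>C v t) (v t)) (at t)"
      by (rule bounded_bilinear.has_vector_derivative[OF bounded_bilinear_inner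
          bounded_linear.has_vector_derivative[OF scaleC.bounded_linear_right g'] v'])
    then show "((\<lambda>t. inner (\<i> *\<^sub>C \<gamma> t) (v t)) has_vector_derivative 0) (at t)"
      by (simp add: a inner_diff_right orth)
  qed
  \<comment> \<open>The derivative of \<open>cis (- t / 2) *\<^sub>C \<gamma> t\<close> is
    \<open>cis (- t / 2) *\<^sub>C u t\<close>, so \<open>u\<close> is the velocity in the rotating
    frame. Its length is the constant \<open>\<omega>\<close>.\<close>
  define u where "u t = v t - (1 / 2) *\<^sub>R \<i> *\<^sub>C \<gamma> t" for t
  have uu: "inner (u t) (u t) = 1 / 4 + 2 * k - D" for t
    using D[of t] by (simp add: u_def inner_diff_left inner_diff_right energy n inner_commute)
  define \<omega> where "\<omega> = sqrt (1 / 4 + 2 * k - D)"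
  have \<omega>: "\<omega>\<^sup>2 = 1 / 4 + 2 * k - D" "\<omega> \<ge> 0" "norm (u t) = \<omega>" for t
    using uu[of 0] inner_ge_zero[of "u 0"] by (simp_all add: \<omega>_def norm_eq_sqrt_inner uu)
  define H where "H t = hprod (\<gamma> t) q\<^sub>1" for t
  define U where "U t = hprod (u t) q\<^sub>1" for t
  have V: "hprod (v t) q\<^sub>1 = U t + \<i> / 2 * H t" for t
    by (simp add: U_def H_def u_def hprod.diff_left hprod_scaleC_left hprod.scaleR_left scaleR_conv_of_real)
  have H': "(H has_vector_derivative U t + \<i> / 2 * H t) (at t)" for t
    using bounded_linear.has_vector_derivative[OF hprod.bounded_linear_left g', of q\<^sub>1 t]
    by (simp add: H_def[abs_def] V)
  \<comment> \<open>Up to the common phase \<open>cis (t / 2)\<close>, the pair \<open>H\<close>,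
    \<open>U\<close> is a harmonic oscillator of frequency \<open>\<omega>\<close>.\<close>
  have U': "(U has_vector_derivative \<i> / 2 * U t - of_real (\<omega>\<^sup>2) * H t) (at t)" for t
  proof -
    have "((\<lambda>t. hprod (v t) q\<^sub>1 - \<i> / 2 * H t) has_vector_derivative
        hprod (a t) q\<^sub>1 - \<i> / 2 * (U t + \<i> / 2 * H t)) (at t)"
      by (intro has_vector_derivative_diff has_vector_derivative_mult_right H'
          bounded_linear.has_vector_derivative[OF hprod.bounded_linear_left v'])
    moreover have "hprod (a t) q\<^sub>1 = \<i> * (U t + \<i> / 2 * H t) - of_real (2 * k - D) * H t"
      by (simp add: a D hprod.diff_left hprod_scaleC_left hprod.scaleR_left scaleR_conv_of_real V H_def)
    ultimately show ?thesis by (simp add: V \<omega>(1) algebra_simps)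
  qed
  have H1: "H t\<^sub>1 = 1" using hprod_self_sphere[OF sph] by (simp add: H_def t)
  have ug: "inner (\<i> *\<^sub>C \<gamma> t) (u t) = D - 1 / 2" for t
    using D[of t] by (simp add: u_def inner_diff_right n)
  have "inner (u t) (\<gamma> t) = 0" for t
    using orth[of t] by (simp add: u_def inner_diff_right inner_commute[of _ "\<gamma> t"])
  then have U1: "U t\<^sub>1 = \<i> * of_real (D - 1 / 2)"
    using ug[of t\<^sub>1] inner_scaleC_i_commute[of "\<gamma> t\<^sub>1" "u t\<^sub>1"]
    by (simp add: U_def t hprod_eq_inner inner_commute complex_eq_iff)
  show thesis
  proof (cases "\<omega> = 0")
    \<comment> \<open>At rest in the rotating frame the curve is a phase rotation. No angle is
      defined, and \<open>c = 0\<close> is taken.\<close>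
    case True
    then have "u t = 0" for t using \<omega>(3)[of t] by simp
    then have U0: "U t = 0" for t by (simp add: U_def hprod.zero_left)
    have "cis (- (1 / 2) * t\<^sub>0) * H t\<^sub>0 = cis (- (1 / 2) * t\<^sub>1) * H t\<^sub>1"
    proof (rule has_vector_derivative_zero_constant[of "\<lambda>t. cis (- (1 / 2) * t) * H t"])
      fix t
      show "((\<lambda>t. cis (- (1 / 2) * t) * H t) has_vector_derivative 0) (at t)"
        using H'[of t] by (auto intro!: derivative_eq_intros simp: U0 scaleR_conv_of_real)
    qed
    then have "cis (t\<^sub>0 / 2) * (cis (- (1 / 2) * t\<^sub>0) * H t\<^sub>0) = cis (t\<^sub>0 / 2) * cis (- (1 / 2) * t\<^sub>1)"
      by (simp add: H1)
    then have "H t\<^sub>0 = cis ((t\<^sub>0 - t\<^sub>1) / 2)"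
      by (simp add: cis_mult diff_divide_distrib flip: mult.assoc)
    moreover have "2 * k = 1 / 4"
      using True arg_cong[OF U1, of Im] \<omega>(1) by (simp add: U0)
    ultimately show ?thesis
      by (intro that[of 0 0 "t\<^sub>0 - t\<^sub>1"]) (simp_all add: H_def t flip: one_complex.code)
  next
    case False
    define c where "c = (D - 1 / 2) / \<omega>"
    have wc: "\<omega> * c = D - 1 / 2" using False by (simp add: c_def)
    \<comment> \<open>Two conserved quantities: the pair \<open>H\<close>,
      \<open>U / \<omega>\<close> with its phase removed and turned back through the angle
      \<open>\<omega> * (t - t\<^sub>1)\<close>. At \<open>t\<^sub>1\<close> they equal
      \<open>1\<close> and \<open>\<i> * c\<close>.\<close>
    define A where "A t = cis (- (1 / 2) * (t - t\<^sub>1)) *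
      (of_real (cos (\<omega> * (t - t\<^sub>1))) * H t - of_real (sin (\<omega> * (t - t\<^sub>1))) * (U t / of_real \<omega>))" for t
    define B where "B t = cis (- (1 / 2) * (t - t\<^sub>1)) *
      (of_real (sin (\<omega> * (t - t\<^sub>1))) * H t + of_real (cos (\<omega> * (t - t\<^sub>1))) * (U t / of_real \<omega>))" for t
    have de: "((\<lambda>t. cis (- (1 / 2) * (t - t\<^sub>1))) has_vector_derivative
        - (\<i> / 2) * cis (- (1 / 2) * (t - t\<^sub>1))) (at t)" for t
      by (auto intro!: derivative_eq_intros simp: scaleR_conv_of_real)
    have dc: "((\<lambda>t. complex_of_real (cos (\<omega> * (t - t\<^sub>1)))) has_vector_derivative
        - of_real \<omega> * of_real (sin (\<omega> * (t - t\<^sub>1)))) (at t)" for t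
      by (rule has_vector_derivative_eq_rhs, rule bounded_linear.has_vector_derivative[OF bounded_linear_of_real])
       (auto intro!: derivative_eq_intros simp flip: has_real_derivative_iff_has_vector_derivative)
    have ds: "((\<lambda>t. complex_of_real (sin (\<omega> * (t - t\<^sub>1)))) has_vector_derivative
        of_real \<omega> * of_real (cos (\<omega> * (t - t\<^sub>1)))) (at t)" for t
      by (rule has_vector_derivative_eq_rhs, rule bounded_linear.has_vector_derivative[OF bounded_linear_of_real])
       (auto intro!: derivative_eq_intros simp flip: has_real_derivative_iff_has_vector_derivative)
    have A: "A t\<^sub>0 = A t\<^sub>1"
    proof (rule has_vector_derivative_zero_constant[of A])
      fix t
      show "(A has_vector_derivative 0) (at t)"
        unfolding A_def
        by (rule has_vector_derivative_eq_rhs,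
            (rule has_vector_derivative_mult has_vector_derivative_diff has_vector_derivative_divide de dc ds H' U')+)
          (use False in \<open>simp add: field_simps power2_eq_square\<close>)
    qed
    have B: "B t\<^sub>0 = B t\<^sub>1"
    proof (rule has_vector_derivative_zero_constant[of B])
      fix t
      show "(B has_vector_derivative 0) (at t)"
        unfolding B_def
        by (rule has_vector_derivative_eq_rhs,
            (rule has_vector_derivative_mult has_vector_derivative_add has_vector_derivative_divide de dc ds H' U')+)
          (use False in \<open>simp add: field_simps power2_eq_square\<close>)
    qed
    define C where "C = complex_of_real (cos (\<omega> * (t\<^sub>0 - t\<^sub>1)))"
    define S where "S = complex_of_real (sin (\<omega> * (t\<^sub>0 - t\<^sub>1)))"
    define e where "e = cis (- (1 / 2) * (t\<^sub>0 - t\<^sub>1))"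
    have e: "cis ((t\<^sub>0 - t\<^sub>1) / 2) * e = 1"
      by (simp add: e_def cis_mult)
    have CS: "C * C + S * S = 1"
      unfolding C_def S_def of_real_mult[symmetric] of_real_add[symmetric]
      by (simp flip: power2_eq_square)
    have A0: "e * (C * H t\<^sub>0 - S * (U t\<^sub>0 / of_real \<omega>)) = 1"
      using A by (simp add: A_def H1 C_def S_def e_def)
    have B0: "e * (S * H t\<^sub>0 + C * (U t\<^sub>0 / of_real \<omega>)) = \<i> * of_real c"
      using B by (simp add: B_def U1 C_def S_def e_def c_def)
    \<comment> \<open>\<open>C\<close> times \<open>A0\<close> plus \<open>S\<close> times
      \<open>B0\<close> eliminates \<open>U t\<^sub>0\<close>.\<close>
    have "C + S * (\<i> * of_real c) = e * ((C * C + S * S) * H t\<^sub>0)"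
      using A0 B0 by algebra
    then have "H t\<^sub>0 = cis ((t\<^sub>0 - t\<^sub>1) / 2) * (C + S * (\<i> * of_real c))"
      using e CS by algebra
    then have "hprod q\<^sub>0 q\<^sub>1 = cis ((t\<^sub>0 - t\<^sub>1) / 2) * Complex (cos (\<omega> * (t\<^sub>0 - t\<^sub>1))) (c * sin (\<omega> * (t\<^sub>0 - t\<^sub>1)))"
      by (simp add: H_def t C_def S_def Complex_eq mult_ac)
    moreover have "\<bar>c\<bar> \<le> 1"
    proof -
      have "\<bar>D - 1 / 2\<bar> \<le> norm (\<i> *\<^sub>C \<gamma> 0) * norm (u 0)"
        unfolding ug[symmetric, of 0] by (rule Cauchy_Schwarz_ineq2)
      also have "\<dots> = \<omega>" using sph[of 0] by (simp add: norm_scaleC \<omega>(3))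
      finally show ?thesis using \<omega>(2) False by (simp add: c_def field_simps)
    qed
    moreover have "2 * k = 1 / 4 + \<omega>\<^sup>2 + \<omega> * c" by (simp add: wc \<omega>(1))
    ultimately show ?thesis by (intro that)
  qed
qed


section \<open>Construction of connecting geodesics\<close>

text \<open>The curve is a great circle from \<open>p\<close> in direction \<open>w\<close>, carried
  along by the phase rotation \<open>cis (t / 2)\<close>. The real part of \<open>wp\<close> makes
  \<open>p\<close> and \<open>w\<close> orthogonal; its imaginary part gives the mixed term
  \<open>\<omega> * c\<close> of the energy.\<close>

lemma sphere_geodesicsI:
  assumes p: "p \<in> L2_sphere" and w: "w \<in> L2_sphere" and wp: "hprod w p = \<i> * of_real c"
    and k: "2 * k = 1 / 4 + \<omega>\<^sup>2 + \<omega> * c"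
    and q\<^sub>0: "cis (t\<^sub>0 / 2) *\<^sub>C (cos (\<omega> * t\<^sub>0) *\<^sub>R p + sin (\<omega> * t\<^sub>0) *\<^sub>R w) = q\<^sub>0"
  shows "sphere_geodesics k q\<^sub>0 p \<noteq> {}"
proof -
  define \<eta> where "\<eta> t = cos (\<omega> * t) *\<^sub>R p + sin (\<omega> * t) *\<^sub>R w" for t
  define \<zeta> where "\<zeta> t = \<omega> *\<^sub>R (cos (\<omega> * t) *\<^sub>R w - sin (\<omega> * t) *\<^sub>R p)" for t
  define \<gamma> where "\<gamma> t = cis (t / 2) *\<^sub>C \<eta> t" for t
  define v where "v t = cis (t / 2) *\<^sub>C ((\<i> / 2) *\<^sub>C \<eta> t + \<zeta> t)" for t
  \<comment> \<open>This will be the acceleration. It differs from \<open>\<i> *\<^sub>C v t\<close>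
    by a multiple of the normal vector \<open>\<gamma> t\<close>, which is exactly the geodesic
    equation.\<close>
  define a where "a t = \<i> *\<^sub>C v t + (1 / 4 - \<omega>\<^sup>2) *\<^sub>R \<gamma> t" for t
  have pp: "inner p p = 1" "inner w w = 1" using p w by (simp_all add: norm_eq_1)
  have pw: "inner w p = 0" "inner p w = 0" "inner (\<i> *\<^sub>C w) p = - c" "inner (\<i> *\<^sub>C p) w = c"
    using wp inner_scaleC_i_commute[of w p]
    by (simp_all add: hprod_eq_inner complex_eq_iff inner_commute)
  have \<eta>: "(\<eta> has_vector_derivative \<zeta> t) (at t)" for t
    unfolding \<eta>_def \<zeta>_def
    by (auto intro!: derivative_eq_intros simp flip: has_real_derivative_iff_has_vector_derivative simp: algebra_simps)
  have \<zeta>: "(\<zeta> has_vector_derivative - (\<omega>\<^sup>2 *\<^sub>R \<eta> t)) (at t)" for t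
    unfolding \<eta>_def \<zeta>_def
    by (auto intro!: derivative_eq_intros simp flip: has_real_derivative_iff_has_vector_derivative simp: algebra_simps power2_eq_square)
  have e: "((\<lambda>t. cis (t / 2)) has_vector_derivative cis (t / 2) * (\<i> / 2)) (at t)" for t
    by (auto intro!: derivative_eq_intros simp: scaleR_conv_of_real)
  have \<gamma>': "(\<gamma> has_vector_derivative v t) (at t)" for t
    unfolding \<gamma>_def
    by (rule has_vector_derivative_eq_rhs[OF has_vector_derivative_scaleC[OF e \<eta>]]) (simp add: v_def scaleC_add_right add.commute)
  have v': "(v has_vector_derivative a t) (at t)" for t
    unfolding v_def
  proof (rule has_vector_derivative_eq_rhs[OF has_vector_derivative_scaleC[OF e has_vector_derivative_add[OF
        bounded_linear.has_vector_derivative[OF scaleC.bounded_linear_right \<eta>] \<zeta>]]])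
    show "cis (t / 2) *\<^sub>C ((\<i> / 2) *\<^sub>C \<zeta> t + - (\<omega>\<^sup>2 *\<^sub>R \<eta> t)) +
      (cis (t / 2) * (\<i> / 2)) *\<^sub>C ((\<i> / 2) *\<^sub>C \<eta> t + \<zeta> t) = a t"
      by (rule L2S1_eqI)
        (simp add: a_def v_def \<gamma>_def hprod_add_left hprod.diff_left hprod.minus_left hprod.scaleR_left hprod_scaleC_left
          scaleR_conv_of_real field_simps)
  qed
  have nn: "inner (\<eta> t) (\<eta> t) = 1" for t
    by (simp add: \<eta>_def inner_add_left inner_add_right pp pw flip: power2_eq_square)
  then have "norm (\<eta> t) = 1" for t by (simp add: norm_eq_sqrt_inner)
  then have sph: "\<gamma> t \<in> L2_sphere" for t by (simp add: \<gamma>_def norm_scaleC)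
  have zz: "inner (\<zeta> t) (\<zeta> t) = \<omega>\<^sup>2" for t
  proof -
    have "inner (\<zeta> t) (\<zeta> t) = \<omega>\<^sup>2 * ((cos (\<omega> * t))\<^sup>2 + (sin (\<omega> * t))\<^sup>2)"
      unfolding \<zeta>_def inner_diff_left inner_diff_right inner_scaleR_left inner_scaleR_right pp pw
      by algebra
    then show ?thesis by simp
  qed
  have nz: "inner (\<i> *\<^sub>C \<eta> t) (\<zeta> t) = \<omega> * c" for t
  proof -
    have "inner (\<i> *\<^sub>C \<eta> t) (\<zeta> t) = \<omega> * c * ((cos (\<omega> * t))\<^sup>2 + (sin (\<omega> * t))\<^sup>2)"
      unfolding \<eta>_def \<zeta>_def scaleC.add_right scaleC.scaleR_right inner_add_left inner_diff_right
        inner_scaleR_left inner_scaleR_right pw inner_scaleC_i_self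
      by algebra
    then show ?thesis by simp
  qed
  have "(norm (v t))\<^sup>2 = 2 * k" for t
  proof -
    have "(norm (v t))\<^sup>2 = inner ((1 / 2) *\<^sub>R \<i> *\<^sub>C \<eta> t + \<zeta> t) ((1 / 2) *\<^sub>R \<i> *\<^sub>C \<eta> t + \<zeta> t)"
      by (simp add: v_def norm_scaleC power2_norm_eq_inner scaleR_L2S1_def)
    also have "\<dots> = 2 * k"
      unfolding k by (simp add: inner_add_left inner_add_right nn zz nz inner_commute[of "\<zeta> t"] field_simps)
    finally show ?thesis .
  qed
  moreover have "velocity \<gamma> = v"
    using \<gamma>' by (auto simp: velocity_def vector_derivative_at)
  moreover have "orth_proj (sphere_tangent (\<gamma> t)) (a t) =
      lorentz_force sphere_tangent (ext_deriv alpha) (\<gamma> t) (v t)" for t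
    unfolding orth_proj_eq_lorentz_force_iff[OF sph]
    using sph[of t] by (simp add: a_def inner_add_right norm_eq_1 algebra_simps)
  moreover have "vector_derivative v (at t) = a t" for t
    using v' by (rule vector_derivative_at)
  moreover have "\<gamma> 0 = p" "\<gamma> t\<^sub>0 = q\<^sub>0" by (simp_all add: \<gamma>_def \<eta>_def q\<^sub>0)
  then have "p \<in> range \<gamma>" "q\<^sub>0 \<in> range \<gamma>" by blast+
  ultimately have "\<gamma> \<in> sphere_geodesics k q\<^sub>0 p"
    unfolding sphere_geodesics_def magnetic_geodesics_def magnetic_geodesic_def covariant_derivative_def
    using sph differentiableI_vector[OF \<gamma>'] differentiableI_vector[OF v'] by simp
  then show ?thesis by blast
qed

text \<open>The direction \<open>w\<close> is obtained by solving the endpoint condition after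
  undoing the phase of \<open>q\<^sub>0\<close>. This divides by \<open>sin (\<omega> * t)\<close>,
  which cannot vanish: otherwise the product would have modulus 1.\<close>

lemma sphere_geodesics_if_hprod:
  assumes q: "q\<^sub>0 \<in> L2_sphere" "q\<^sub>1 \<in> L2_sphere" and h: "cmod (hprod q\<^sub>0 q\<^sub>1) < 1"
    and k: "2 * k = 1 / 4 + \<omega>\<^sup>2 + \<omega> * c"
    and eq: "hprod q\<^sub>0 q\<^sub>1 = cis (t / 2) * Complex (cos (\<omega> * t)) (c * sin (\<omega> * t))"
  shows "sphere_geodesics k q\<^sub>0 q\<^sub>1 \<noteq> {}"
proof -
  define q where "q = cis (- (t / 2)) *\<^sub>C q\<^sub>0"
  define S where "S = sin (\<omega> * t)"
  define C where "C = cos (\<omega> * t)"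
  have qs: "q \<in> L2_sphere" using q by (simp add: q_def norm_scaleC)
  have hq: "hprod q q\<^sub>1 = Complex C (c * S)"
    by (simp add: q_def hprod_scaleC_left eq cis_mult C_def S_def flip: mult.assoc)
  have C2: "C\<^sup>2 = 1 - S\<^sup>2" by (simp add: C_def S_def cos_squared_eq)
  have S0: "S \<noteq> 0"
  proof
    assume "S = 0"
    then have "hprod q\<^sub>0 q\<^sub>1 = cis (t / 2) * of_real C" "\<bar>C\<bar> = 1"
      using C2 by (simp_all add: eq C_def S_def Complex_eq abs_square_eq_1)
    then show False using h by (simp add: norm_mult)
  qed
  define w where "w = (1 / S) *\<^sub>R (q - C *\<^sub>R q\<^sub>1)"
  have "inner q q\<^sub>1 = C" using hq by (simp add: inner_L2S1_def)
  then have "inner (q - C *\<^sub>R q\<^sub>1) (q - C *\<^sub>R q\<^sub>1) = 1 - C\<^sup>2"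
    using q qs by (simp add: inner_diff_left inner_diff_right norm_eq_1 inner_commute power2_eq_square)
  then have "inner w w = 1" using S0 by (simp add: w_def C2) (simp add: power2_eq_square)
  then have "w \<in> L2_sphere" by (simp add: norm_eq_1)
  moreover have "hprod w q\<^sub>1 = \<i> * of_real c"
    using S0 hprod_self_sphere[OF q(2)]
    by (simp add: w_def hprod.scaleR_left hprod.diff_left hq complex_eq_iff)
  moreover have "cis (t / 2) *\<^sub>C (cos (\<omega> * t) *\<^sub>R q\<^sub>1 + sin (\<omega> * t) *\<^sub>R w) = q\<^sub>0"
    using S0 by (simp add: w_def q_def cis_mult flip: C_def S_def)
  ultimately show ?thesis
    by (rule sphere_geodesicsI[OF q(2) _ _ k])
qed

text \<open>By the equality case of Cauchy-Schwarz, \<open>q\<^sub>0\<close> is a phase multiple of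
  \<open>q\<^sub>1\<close>, and the phase circle through \<open>q\<^sub>1\<close>, run at speed
  \<open>sqrt (2 * k)\<close>, joins them.\<close>

lemma sphere_geodesics_same_line:
  assumes q: "q\<^sub>0 \<in> L2_sphere" "q\<^sub>1 \<in> L2_sphere" and h: "cmod (hprod q\<^sub>0 q\<^sub>1) = 1" and k: "k > 0"
  shows "sphere_geodesics k q\<^sub>0 q\<^sub>1 \<noteq> {}"
proof -
  let ?h = "hprod q\<^sub>0 q\<^sub>1"
  define s where "s = sqrt (2 * k)"
  have s: "s > 0" "s\<^sup>2 = 2 * k" using k by (simp_all add: s_def)
  have "inner q\<^sub>0 (?h *\<^sub>C q\<^sub>1) = 1"
    using h by (simp add: inner_L2S1_def hprod_scaleC_right complex_norm_square[symmetric] mult.commute[of "cnj _"])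
  then have q0: "q\<^sub>0 = ?h *\<^sub>C q\<^sub>1"
    using q h by (subst vector_eq) (simp add: norm_scaleC flip: power2_norm_eq_inner)
  have hc: "?h = cis (Arg ?h)" using h rcis_cmod_Arg[of ?h] by (simp add: rcis_def)
  have rotation: "cos x *\<^sub>R q\<^sub>1 + sin x *\<^sub>R \<i> *\<^sub>C q\<^sub>1 = cis x *\<^sub>C q\<^sub>1" for x
  proof -
    have "cis x = of_real (cos x) + of_real (sin x) * \<i>" by (simp add: complex_eq_iff)
    then show ?thesis by (simp add: scaleR_L2S1_def scaleC_add_left)
  qed
  define t where "t = Arg ?h / s"
  \<comment> \<open>Taking \<open>w = \<i> *\<^sub>C q\<^sub>1\<close>, hence \<open>c = 1\<close>,
    makes the great circle a phase rotation at rate \<open>\<omega>\<close>; the total rate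
    \<open>\<omega> + 1 / 2\<close> must be \<open>s\<close>.\<close>
  have "cis (t / 2) *\<^sub>C (cos ((s - 1 / 2) * t) *\<^sub>R q\<^sub>1 + sin ((s - 1 / 2) * t) *\<^sub>R \<i> *\<^sub>C q\<^sub>1) = q\<^sub>0"
  proof -
    have "cis (t / 2) *\<^sub>C (cos ((s - 1 / 2) * t) *\<^sub>R q\<^sub>1 + sin ((s - 1 / 2) * t) *\<^sub>R \<i> *\<^sub>C q\<^sub>1)
        = (cis (t / 2) * cis ((s - 1 / 2) * t)) *\<^sub>C q\<^sub>1"
      by (simp add: rotation)
    also have "cis (t / 2) * cis ((s - 1 / 2) * t) = ?h"
      using s(1) by (subst hc) (simp add: cis_mult t_def field_simps)
    finally show ?thesis using q0 by simp
  qed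
  moreover have "2 * k = 1 / 4 + (s - 1 / 2)\<^sup>2 + (s - 1 / 2) * 1"
    using s(2) by (simp add: power2_eq_square algebra_simps)
  moreover have "\<i> *\<^sub>C q\<^sub>1 \<in> L2_sphere" using q by (simp add: norm_scaleC)
  moreover have "hprod (\<i> *\<^sub>C q\<^sub>1) q\<^sub>1 = \<i> * of_real 1"
    using hprod_self_sphere[OF q(2)] by (simp add: hprod_scaleC_left)
  ultimately show ?thesis
    by (intro sphere_geodesicsI[OF q(2)])
qed

section \<open>Sweeping the phase at a given modulus\<close>

text \<open>For large \<open>n\<close> the endpoint values of \<open>g + n f\<close> differ by at
  least \<open>T\<close>, so an element of the progression lies between them and the intermediate
  value theorem applies.\<close>

lemma integer_multiple_ivt:
  fixes f g :: "real \<Rightarrow> real"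
  assumes ab: "a \<le> b" and f: "continuous_on {a..b} f" and g: "continuous_on {a..b} g"
    and ne: "f a \<noteq> f b" and T: "T > 0"
  obtains n :: nat and m :: int and x where "x \<in> {a..b}" "g x + real n * f x = y + T * real_of_int m"
proof -
  obtain n :: nat where n: "T + \<bar>g a - g b\<bar> < real n * \<bar>f a - f b\<bar>"
    using reals_Archimedean3[of "\<bar>f a - f b\<bar>"] ne by auto
  define F where "F x = g x + real n * f x" for x
  \<comment> \<open>The first term of the progression at or above the smaller endpoint
    value.\<close>
  define m where "m = \<lceil>(min (F a) (F b) - y) / T\<rceil>"
  have F: "continuous_on {a..b} F" unfolding F_def by (intro continuous_intros f g)
  have "real n * \<bar>f a - f b\<bar> = \<bar>F a - F b - (g a - g b)\<bar>"
    by (simp add: F_def abs_mult flip: right_diff_distrib)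
  then have diff: "T \<le> \<bar>F a - F b\<bar>" using n by linarith
  have "(min (F a) (F b) - y) / T \<le> m" "m \<le> (min (F a) (F b) - y) / T + 1"
    unfolding m_def by linarith+
  then have *: "min (F a) (F b) \<le> y + T * m" "y + T * m \<le> min (F a) (F b) + T"
    using T by (simp_all add: field_simps)
  have "\<exists>x. a \<le> x \<and> x \<le> b \<and> F x = y + T * m"
  proof (cases "F a \<le> F b")
    case True
    then show ?thesis using * diff by (intro IVT'[OF _ _ ab F]) auto
  next
    case False
    then show ?thesis using * diff by (intro IVT2'[OF _ _ ab F]) auto
  qed
  then show ?thesis using that unfolding F_def by auto
qed

text \<open>
  For every value of the parameter \<open>c\<close> the modulus of \<open>hprod q\<^sub>0 q\<^sub>1\<close> is matched by a time \<open>\<psi> / \<nu>\<close> and its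
  translates by \<open>2 * pi / \<nu>\<close>. Since \<open>\<nu>\<close> depends on \<open>c\<close>, after many such translations the phase sweeps
  out a full circle as \<open>c\<close> varies.
\<close>

lemma sphere_geodesics_nonempty:
  assumes q: "q\<^sub>0 \<in> L2_sphere" "q\<^sub>1 \<in> L2_sphere"
    and r: "0 < cmod (hprod q\<^sub>0 q\<^sub>1)" "cmod (hprod q\<^sub>0 q\<^sub>1) < 1"
    and k: "1 - 8 * k < (cmod (hprod q\<^sub>0 q\<^sub>1))\<^sup>2"
  shows "sphere_geodesics k q\<^sub>0 q\<^sub>1 \<noteq> {}"
proof -
  define r where "r = cmod (hprod q\<^sub>0 q\<^sub>1)"
  have r0: "0 < r" "r < 1" "1 - 8 * k < r\<^sup>2" using r k by (simp_all add: r_def)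
  \<comment> \<open>The root keeps the discriminant of the energy equation nonnegative for
    \<open>c \<ge> c\<^sub>1\<close>. For \<open>k \<ge> 1 / 8\<close> it is at most 0, as
    \<open>sqrt\<close> is odd, and \<open>r / 2\<close> keeps \<open>c\<close> positive.\<close>
  define c\<^sub>1 where "c\<^sub>1 = max (r / 2) (sqrt (1 - 8 * k))"
  have "sqrt (1 - 8 * k) < r" using r0 by (intro real_less_lsqrt) auto
  then have c1: "0 < c\<^sub>1" "c\<^sub>1 < r" using r0 by (auto simp: c\<^sub>1_def)
  have c1k: "1 - 8 * k \<le> c\<^sub>1\<^sup>2"
    using c1(1) by (intro sqrt_le_D) (simp add: c\<^sub>1_def)
  \<comment> \<open>\<open>\<nu> c\<close> is the larger root of the energy equation with
    \<open>- c\<close> as its parameter. \<open>x c\<close> is the value of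
    \<open>cos (\<nu> c * t)\<close> for which the product has modulus \<open>r\<close>, by
    \<open>r\<^sup>2 = c\<^sup>2 + (1 - c\<^sup>2) * (x c)\<^sup>2\<close>.\<close>
  define \<nu> where "\<nu> c = (c + sqrt (c\<^sup>2 + 8 * k - 1)) / 2" for c
  define x where "x c = sqrt ((r\<^sup>2 - c\<^sup>2) / (1 - c\<^sup>2))" for c
  have disc: "c\<^sup>2 + 8 * k - 1 \<ge> 0" and \<nu>0: "\<nu> c > 0" and \<nu>: "2 * k = 1 / 4 + (\<nu> c)\<^sup>2 + \<nu> c * (- c)"
    and c2: "c\<^sup>2 \<le> r\<^sup>2" "c\<^sup>2 < 1" if "c \<in> {c\<^sub>1..r}" for c
  proof -
    have "c\<^sub>1\<^sup>2 \<le> c\<^sup>2" using that c1 by (intro power_mono) auto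
    then show d: "c\<^sup>2 + 8 * k - 1 \<ge> 0" using c1k by linarith
    then show "\<nu> c > 0" using that c1 by (auto simp: \<nu>_def intro!: add_pos_nonneg)
    show "2 * k = 1 / 4 + (\<nu> c)\<^sup>2 + \<nu> c * (- c)"
    proof -
      define s where "s = sqrt (c\<^sup>2 + 8 * k - 1)"
      have "1 / 4 + ((c + s) / 2)\<^sup>2 + (c + s) / 2 * (- c) = 1 / 4 + (s\<^sup>2 - c\<^sup>2) / 4"
        by (simp add: power2_eq_square field_simps)
      also have "\<dots> = 2 * k" using d by (simp add: s_def field_simps)
      finally show ?thesis by (simp add: \<nu>_def s_def)
    qed
    show "c\<^sup>2 \<le> r\<^sup>2" using that c1 by (intro power_mono) auto
    also have "r\<^sup>2 < 1" using r0 by (simp add: power_less_one_iff)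
    finally show "c\<^sup>2 < 1" .
  qed
  have x0: "0 \<le> x c" and xr: "x c \<le> r" and x2: "r\<^sup>2 - (x c)\<^sup>2 = c\<^sup>2 * (1 - (x c)\<^sup>2)" if "c \<in> {c\<^sub>1..r}" for c
  proof -
    have c: "c\<^sup>2 \<le> r\<^sup>2" "c\<^sup>2 < 1" using c2 that by auto
    then show "0 \<le> x c" by (simp add: x_def)
    have xx: "(x c)\<^sup>2 = (r\<^sup>2 - c\<^sup>2) / (1 - c\<^sup>2)" using c by (simp add: x_def)
    then show eq: "r\<^sup>2 - (x c)\<^sup>2 = c\<^sup>2 * (1 - (x c)\<^sup>2)" using c by (simp add: field_simps)
    have "(x c)\<^sup>2 \<le> 1" unfolding xx using c r0 by (simp add: power_le_one)
    then have "0 \<le> c\<^sup>2 * (1 - (x c)\<^sup>2)" by simp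
    then have "(x c)\<^sup>2 \<le> r\<^sup>2" unfolding eq[symmetric] by linarith
    then show "x c \<le> r" by (rule power2_le_imp_le) (use r0 in simp)
  qed
  have cx: "continuous_on {c\<^sub>1..r} x"
    unfolding x_def using c2(2) by (intro continuous_intros) force
  have c\<nu>: "continuous_on {c\<^sub>1..r} \<nu>" unfolding \<nu>_def by (intro continuous_intros) auto
  \<comment> \<open>\<open>\<psi> c\<close> is the first angle with cosine \<open>x c\<close>, and
    \<open>- \<beta> c\<close> is the argument of the point with real part \<open>x c\<close> and
    imaginary part \<open>- c * sin (\<psi> c)\<close>.\<close>
  define \<psi> where "\<psi> c = arccos (x c)" for c
  define \<beta> where "\<beta> c = arccos (x c / r)" for c
  have "\<nu> c\<^sub>1 \<noteq> \<nu> r"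
  proof
    assume eq: "\<nu> c\<^sub>1 = \<nu> r"
    have "\<nu> r * c\<^sub>1 = \<nu> r * r" using \<nu>[of c\<^sub>1] \<nu>[of r] c1 eq by simp
    then show False using \<nu>0[of r] c1 by simp
  qed
  moreover have "\<nu> c\<^sub>1 \<noteq> 0" "\<nu> r \<noteq> 0" using \<nu>0[of c\<^sub>1] \<nu>0[of r] c1 by auto
  ultimately have ne: "pi / \<nu> c\<^sub>1 \<noteq> pi / \<nu> r" by (simp add: field_simps)
  have cf: "continuous_on {c\<^sub>1..r} (\<lambda>c. pi / \<nu> c)"
    using \<nu>0 by (intro continuous_intros c\<nu>) force
  have cg: "continuous_on {c\<^sub>1..r} (\<lambda>c. \<psi> c / (2 * \<nu> c) - \<beta> c)"
  proof (unfold \<psi>_def \<beta>_def, intro continuous_intros cx c\<nu>)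
    show "\<forall>c\<in>{c\<^sub>1..r}. - 1 \<le> x c \<and> x c \<le> 1" using x0 xr r0 by force
    show "\<forall>c\<in>{c\<^sub>1..r}. - 1 \<le> x c / r \<and> x c / r \<le> 1"
    proof
      fix c assume "c \<in> {c\<^sub>1..r}"
      then have "0 \<le> x c / r" "x c / r \<le> 1" using x0 xr r0 by auto
      then show "- 1 \<le> x c / r \<and> x c / r \<le> 1" by linarith
    qed
  qed (use \<nu>0 r0 in force)+
  \<comment> \<open>With \<open>n\<close> extra turns the time is
    \<open>(\<psi> c + 2 * n * pi) / \<nu> c\<close>, so the left side of \<open>phase\<close> is
    \<open>t / 2 - \<beta> c\<close>, the phase to be matched modulo \<open>2 * pi\<close>.\<close>
  obtain n :: nat and m :: int and c where c: "c \<in> {c\<^sub>1..r}"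
    and phase: "\<psi> c / (2 * \<nu> c) - \<beta> c + real n * (pi / \<nu> c) = Arg (hprod q\<^sub>0 q\<^sub>1) + 2 * pi * real_of_int m"
    by (rule integer_multiple_ivt[OF less_imp_le[OF c1(2)] cf cg ne, of "2 * pi" "Arg (hprod q\<^sub>0 q\<^sub>1)"])
      (simp, rule that)
  define t where "t = (\<psi> c + 2 * real n * pi) / \<nu> c"
  have \<nu>t: "\<nu> c * t = \<psi> c + 2 * real n * pi" using \<nu>0[OF c] by (simp add: t_def)
  have bounds: "0 \<le> x c" "x c \<le> 1" "0 \<le> x c / r" "x c / r \<le> 1"
    using x0[OF c] xr[OF c] r0 by auto
  have ct: "cos (\<nu> c * t) = x c" and st: "sin (\<nu> c * t) = sqrt (1 - (x c)\<^sup>2)"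
    using bounds by (simp_all add: \<nu>t \<psi>_def cos_add sin_add cos_arccos sin_arccos)
  have cos_\<beta>: "cos (\<beta> c) = x c / r"
    unfolding \<beta>_def by (rule cos_arccos; use bounds in linarith)
  have "r * sin (\<beta> c) = c * sqrt (1 - (x c)\<^sup>2)"
  proof (rule power2_eq_imp_eq)
    have "(sin (\<beta> c))\<^sup>2 = 1 - (x c / r)\<^sup>2"
      by (simp add: sin_squared_eq cos_\<beta>)
    then have "(r * sin (\<beta> c))\<^sup>2 = r\<^sup>2 - (x c)\<^sup>2"
      using r0(1) by (simp add: power_mult_distrib power_divide right_diff_distrib)
    also have "\<dots> = (c * sqrt (1 - (x c)\<^sup>2))\<^sup>2"
      using bounds by (simp add: x2[OF c] power_mult_distrib abs_square_le_1)
    finally show "(r * sin (\<beta> c))\<^sup>2 = (c * sqrt (1 - (x c)\<^sup>2))\<^sup>2" .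
    have "0 \<le> \<beta> c" "\<beta> c \<le> pi"
      unfolding \<beta>_def by (rule arccos_lbound arccos_ubound; use bounds in linarith)+
    then show "0 \<le> r * sin (\<beta> c)" using r0 by (intro mult_nonneg_nonneg sin_ge_zero) auto
    have "0 \<le> c" using c c1 by simp
    then show "0 \<le> c * sqrt (1 - (x c)\<^sup>2)"
      using bounds by (intro mult_nonneg_nonneg) (simp_all add: power_le_one)
  qed
  moreover have "r * cos (\<beta> c) = x c" using r0 by (simp add: cos_\<beta>)
  ultimately have "Complex (cos (\<nu> c * t)) (- c * sin (\<nu> c * t)) = of_real r * cis (- \<beta> c)"
    by (simp add: ct st complex_eq_iff)
  then have "cis (t / 2) * Complex (cos (\<nu> c * t)) (- c * sin (\<nu> c * t)) = of_real r * cis (t / 2 - \<beta> c)"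
    by (simp add: cis_mult)
  also have "t / 2 - \<beta> c = Arg (hprod q\<^sub>0 q\<^sub>1) + 2 * pi * real_of_int m"
  proof -
    have "t / 2 = \<psi> c / (2 * \<nu> c) + real n * (pi / \<nu> c)"
      by (simp add: t_def add_divide_distrib)
    then show ?thesis using phase by linarith
  qed
  also have "of_real r * cis \<dots> = hprod q\<^sub>0 q\<^sub>1"
    using rcis_cmod_Arg[of "hprod q\<^sub>0 q\<^sub>1"]
    by (simp add: r_def rcis_def flip: cis_mult)
  finally show ?thesis
    by (rule sphere_geodesics_if_hprod[OF q r(2) \<nu>[OF c] sym])
qed

section \<open>Lower bounds for the modulus and the boundary case\<close>

text \<open>The first identity completes the square in the energy equation. For
  \<open>\<bar>c\<bar> \<le> 1\<close> both exhibit the excess over a lower bound as a nonnegative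
  term, which also settles the equality case.\<close>

lemma sphere_geodesic_hprod_bounds:
  assumes k: "2 * k = 1 / 4 + \<omega>\<^sup>2 + \<omega> * c" and h: "h = cis (t / 2) * Complex (cos (\<omega> * t)) (c * sin (\<omega> * t))"
  shows "c\<^sup>2 = 1 - 8 * k + (2 * \<omega> + c)\<^sup>2" "(cmod h)\<^sup>2 = c\<^sup>2 + (1 - c\<^sup>2) * (cos (\<omega> * t))\<^sup>2"
proof -
  show "c\<^sup>2 = 1 - 8 * k + (2 * \<omega> + c)\<^sup>2" using k by (simp add: power2_eq_square algebra_simps)
  show "(cmod h)\<^sup>2 = c\<^sup>2 + (1 - c\<^sup>2) * (cos (\<omega> * t))\<^sup>2"
    unfolding h norm_mult norm_cis
    by (simp add: cmod_power2 power_mult_distrib sin_squared_eq) (simp add: algebra_simps)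
qed

lemma cmod_hprod_ge_if_geodesic:
  assumes "sphere_geodesics k q\<^sub>0 q\<^sub>1 \<noteq> {}"
  shows "1 - 8 * k \<le> (cmod (hprod q\<^sub>0 q\<^sub>1))\<^sup>2"
proof -
  obtain \<gamma> where "\<gamma> \<in> sphere_geodesics k q\<^sub>0 q\<^sub>1" using assms by blast
  then obtain t \<omega> c where c: "\<bar>c\<bar> \<le> 1" and *: "2 * k = 1 / 4 + \<omega>\<^sup>2 + \<omega> * c"
    "hprod q\<^sub>0 q\<^sub>1 = cis (t / 2) * Complex (cos (\<omega> * t)) (c * sin (\<omega> * t))"
    by (rule sphere_geodesic_hprod)
  from c have "0 \<le> (1 - c\<^sup>2) * (cos (\<omega> * t))\<^sup>2" by (simp add: abs_square_le_1)
  then show ?thesis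
    using sphere_geodesic_hprod_bounds[OF *] zero_le_power2[of "2 * \<omega> + c"] by linarith
qed

text \<open>A zero product would force \<open>cos (\<omega> * t) = 0\<close> and hence
  \<open>c = 0\<close>; at energy 1/8 this gives \<open>\<omega> = 0\<close>, where the cosine is
  1.\<close>

lemma hprod_nonzero_if_critical_geodesic:
  assumes "sphere_geodesics (1 / 8) q\<^sub>0 q\<^sub>1 \<noteq> {}"
  shows "hprod q\<^sub>0 q\<^sub>1 \<noteq> 0"
proof
  assume h: "hprod q\<^sub>0 q\<^sub>1 = 0"
  obtain \<gamma> where "\<gamma> \<in> sphere_geodesics (1 / 8) q\<^sub>0 q\<^sub>1" using assms by blast
  then obtain t \<omega> c where c: "\<bar>c\<bar> \<le> 1" and *: "2 * (1 / 8) = 1 / 4 + \<omega>\<^sup>2 + \<omega> * c"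
    "hprod q\<^sub>0 q\<^sub>1 = cis (t / 2) * Complex (cos (\<omega> * t)) (c * sin (\<omega> * t))"
    by (rule sphere_geodesic_hprod)
  have "Complex (cos (\<omega> * t)) (c * sin (\<omega> * t)) = 0"
    using h *(2) by (metis cis_neq_zero mult_eq_0_iff)
  then have "cos (\<omega> * t) = 0" "c * sin (\<omega> * t) = 0"
    by (simp_all add: complex_eq_iff)
  then have "c = 0" "cos (\<omega> * t) = 0" using sin_cos_squared_add[of "\<omega> * t"] by auto
  with *(1) show False by simp
qed

text \<open>These are the zeros of the cosine for \<open>\<omega> = \<rho> / 2\<close> and
  \<open>c = - \<rho>\<close>. From one to the next, \<open>t / 2\<close> grows by
  \<open>pi / \<rho>\<close> and the sine changes sign, adding \<open>pi\<close>.\<close>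

lemma phase_at_critical_time:
  assumes "\<rho> > 0"
  shows "cis ((pi + 2 * pi * real_of_int m) / \<rho> / 2) *
      Complex (cos (\<rho> / 2 * ((pi + 2 * pi * real_of_int m) / \<rho>)))
        (- \<rho> * sin (\<rho> / 2 * ((pi + 2 * pi * real_of_int m) / \<rho>)))
    = cis (pi / (2 * \<rho>) - pi / 2 + real_of_int m * (pi / \<rho> + pi)) * of_real \<rho>"
proof -
  have "\<rho> / 2 * ((pi + 2 * pi * real_of_int m) / \<rho>) = real_of_int m * pi + pi / 2"
    using assms by (simp add: field_simps)
  moreover have "sin (real_of_int m * pi) = 0"
    using sin_npi_int[of m] by (simp add: mult.commute)
  ultimately have "Complex (cos (\<rho> / 2 * ((pi + 2 * pi * real_of_int m) / \<rho>)))
        (- \<rho> * sin (\<rho> / 2 * ((pi + 2 * pi * real_of_int m) / \<rho>)))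
     = of_real \<rho> * cis (real_of_int m * pi - pi / 2)"
    by (simp add: complex_eq_iff cos_add sin_add cos_diff sin_diff)
  then show ?thesis
    using assms by (simp add: cis_mult mult.left_commute[of "cis _"] add_divide_distrib algebra_simps)
qed

lemma sphere_geodesics_boundary_iff:
  assumes q: "q\<^sub>0 \<in> L2_sphere" "q\<^sub>1 \<in> L2_sphere" and \<rho>: "0 < \<rho>" "\<rho> < 1" and k: "8 * k = 1 - \<rho>\<^sup>2"
    and h: "cmod (hprod q\<^sub>0 q\<^sub>1) = \<rho>"
  shows "sphere_geodesics k q\<^sub>0 q\<^sub>1 \<noteq> {} \<longleftrightarrow>
    (\<exists>m::int. hprod q\<^sub>0 q\<^sub>1 = cis (pi / (2 * \<rho>) - pi / 2 + of_int m * (pi / \<rho> + pi)) * of_real \<rho>)"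
proof
  assume "sphere_geodesics k q\<^sub>0 q\<^sub>1 \<noteq> {}"
  then obtain \<gamma> where "\<gamma> \<in> sphere_geodesics k q\<^sub>0 q\<^sub>1" by blast
  then obtain t \<omega> c where c: "\<bar>c\<bar> \<le> 1" and *: "2 * k = 1 / 4 + \<omega>\<^sup>2 + \<omega> * c"
    "hprod q\<^sub>0 q\<^sub>1 = cis (t / 2) * Complex (cos (\<omega> * t)) (c * sin (\<omega> * t))"
    by (rule sphere_geodesic_hprod)
  from c have "0 \<le> (1 - c\<^sup>2) * (cos (\<omega> * t))\<^sup>2" by (simp add: abs_square_le_1)
  \<comment> \<open>The squared modulus is \<open>1 - 8 * k\<close>, which is
    \<open>\<rho>\<^sup>2\<close>, plus two nonnegative terms, so both vanish.\<close>
  then have eqs: "(2 * \<omega> + c)\<^sup>2 = 0" "(1 - c\<^sup>2) * (cos (\<omega> * t))\<^sup>2 = 0" "c\<^sup>2 = \<rho>\<^sup>2"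
    using sphere_geodesic_hprod_bounds[OF *] zero_le_power2[of "2 * \<omega> + c"] k unfolding h by linarith+
  have "\<rho>\<^sup>2 < 1" using \<rho> by (simp add: power_less_one_iff)
  then have "cos (\<omega> * t) = 0" using eqs by simp
  have c: "c = \<rho> \<or> c = - \<rho>" using eqs(3) by (simp add: power2_eq_iff)
  have \<omega>: "\<omega> = - c / 2" using eqs(1) by simp
  \<comment> \<open>Changing the signs of \<open>c\<close> and \<open>\<omega>\<close> together
    leaves the product unchanged, so the choice \<open>c = - \<rho>\<close>,
    \<open>\<omega> = \<rho> / 2\<close> covers both cases.\<close>
  from c have eq: "Complex (cos (\<omega> * t)) (c * sin (\<omega> * t)) = Complex (cos (\<rho> / 2 * t)) (- \<rho> * sin (\<rho> / 2 * t))"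
    and "cos (\<rho> / 2 * t) = 0"
    using \<open>cos (\<omega> * t) = 0\<close> by (auto simp: \<omega>)
  then obtain m :: int where "\<rho> / 2 * t = of_int m * pi + pi / 2" by (auto simp: cos_zero_iff_int2)
  then have "t = (pi + 2 * pi * real_of_int m) / \<rho>" using \<rho> by (simp add: field_simps)
  then show "\<exists>m::int. hprod q\<^sub>0 q\<^sub>1 = cis (pi / (2 * \<rho>) - pi / 2 + of_int m * (pi / \<rho> + pi)) * of_real \<rho>"
    using phase_at_critical_time[OF \<rho>(1), of m] *(2) unfolding eq by metis
next
  assume "\<exists>m::int. hprod q\<^sub>0 q\<^sub>1 = cis (pi / (2 * \<rho>) - pi / 2 + of_int m * (pi / \<rho> + pi)) * of_real \<rho>"
  then obtain m :: int where m: "hprod q\<^sub>0 q\<^sub>1 = cis (pi / (2 * \<rho>) - pi / 2 + of_int m * (pi / \<rho> + pi)) * of_real \<rho>" ..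
  have "2 * k = 1 / 4 + (\<rho> / 2)\<^sup>2 + \<rho> / 2 * (- \<rho>)"
    using k by (simp add: power2_eq_square field_simps)
  then show "sphere_geodesics k q\<^sub>0 q\<^sub>1 \<noteq> {}"
  proof (rule sphere_geodesics_if_hprod[OF q, rotated])
    show "cmod (hprod q\<^sub>0 q\<^sub>1) < 1" using h \<rho> by simp
  qed (simp only: m phase_at_critical_time[OF \<rho>(1), symmetric])
qed

section \<open>The norm of the one-form and the critical value\<close>

lemma L2_sphere_nonempty: "L2_sphere \<noteq> {}"
proof -
  have "sq_integrable (\<lambda>_. 1)" by (simp add: sq_integrable_def)
  from norm_abs_L2S1[OF this] have "(norm (abs_L2S1 (\<lambda>_. 1)))\<^sup>2 = 1"
    using emeasure_space_circle by (simp add: measure_def)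
  then have "norm (abs_L2S1 (\<lambda>_. 1)) = 1"
    using norm_ge_zero[of "abs_L2S1 (\<lambda>_. 1)"] by (auto simp only: power2_eq_1_iff)
  then have "abs_L2S1 (\<lambda>_. 1) \<in> L2_sphere" by simp
  then show ?thesis by blast
qed

lemma alpha_eq_inner: "alpha f F = inner (\<i> *\<^sub>C f) F / 2"
  by (simp add: alpha_def inner_L2S1_def)

lemma alpha_le:
  assumes "f \<in> L2_sphere" shows "\<bar>alpha f F\<bar> \<le> norm F / 2"
  using Cauchy_Schwarz_ineq2[of "\<i> *\<^sub>C f" F] assms by (simp add: alpha_eq_inner norm_scaleC)

lemma oneform_norm_alpha: "oneform_norm L2_sphere sphere_tangent alpha = 1 / 2"
proof -
  have "(SUP v\<in>sphere_tangent q. \<bar>alpha q v\<bar> / norm v) = 1 / 2" if q: "q \<in> L2_sphere" for q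
  proof (rule cSup_eq_maximum)
    have "\<bar>alpha q (\<i> *\<^sub>C q)\<bar> / norm (\<i> *\<^sub>C q) = 1 / 2"
      using q by (simp add: alpha_eq_inner norm_scaleC flip: power2_norm_eq_inner)
    moreover have "\<i> *\<^sub>C q \<in> sphere_tangent q" by (simp add: sphere_tangent_eq)
    ultimately show "1 / 2 \<in> (\<lambda>v. \<bar>alpha q v\<bar> / norm v) ` sphere_tangent q" by force
    show "y \<le> 1 / 2" if "y \<in> (\<lambda>v. \<bar>alpha q v\<bar> / norm v) ` sphere_tangent q" for y
      \<comment> \<open>The zero vector contributes 0, since division by zero yields 0.\<close>
      using that alpha_le[OF q] by (auto simp: divide_le_eq)
  qed
  then have "oneform_norm L2_sphere sphere_tangent alpha = (SUP q\<in>L2_sphere. 1 / 2)"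
    unfolding oneform_norm_def by (intro SUP_cong) auto
  then show ?thesis using L2_sphere_nonempty by simp
qed

lemma action_nonneg:
  assumes k: "1 / 8 \<le> k" and \<gamma>: "H1_curve T L2_sphere \<gamma> \<gamma>'"
  shows "0 \<le> action (magnetic_lagrangian alpha) k T \<gamma> \<gamma>'"
  unfolding action_def
proof (rule Bochner_Integration.integral_nonneg)
  fix t assume "t \<in> space (lebesgue_on {0..T})"
  moreover have "\<forall>t\<in>{0..T}. \<gamma> t \<in> L2_sphere" using \<gamma> unfolding H1_curve_def by (rule conjunct1)
  ultimately have "\<gamma> t \<in> L2_sphere" by simp
  then have "alpha (\<gamma> t) (\<gamma>' t) \<le> norm (\<gamma>' t) / 2" using alpha_le by (meson abs_le_D1)
  moreover have "0 \<le> (norm (\<gamma>' t) - 1 / 2)\<^sup>2" by simp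
  ultimately show "0 \<le> magnetic_lagrangian alpha (\<gamma> t) (\<gamma>' t) + k"
    using k by (simp add: magnetic_lagrangian_def power2_eq_square algebra_simps)
qed

text \<open>The half-speed phase rotation closes up after time \<open>4 * pi\<close>. Along it the
  kinetic term is 1/8 and \<open>alpha\<close> of the velocity is 1/4, so the integrand is the
  constant \<open>k - 1 / 8\<close>.\<close>

lemma negative_action_loop:
  assumes k: "k < 1 / 8" and q: "q \<in> L2_sphere"
  defines "\<gamma> \<equiv> \<lambda>t. cis (t / 2) *\<^sub>C q" and "\<gamma>' \<equiv> \<lambda>t. (\<i> / 2 * cis (t / 2)) *\<^sub>C q"
  shows "H1_curve (4 * pi) L2_sphere \<gamma> \<gamma>'" "\<gamma> 0 = \<gamma> (4 * pi)"
    "action (magnetic_lagrangian alpha) k (4 * pi) \<gamma> \<gamma>' < 0"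
proof -
  have n: "norm (\<gamma>' t) = 1 / 2" for t using q by (simp add: \<gamma>'_def norm_scaleC norm_mult norm_divide)
  have cont: "continuous_on S (\<lambda>t. \<i> / 2 * cis (t / 2))" for S
    by (intro continuous_intros) auto
  have fint: "integrable (lebesgue_on {0..t}) (\<lambda>t. \<i> / 2 * cis (t / 2))" for t
    by (rule continuous_imp_integrable_real) (rule cont)
  \<comment> \<open>The curve is a complex function times the fixed vector \<open>q\<close>, so it
    suffices to integrate the function and apply the bounded linear map
    \<open>\<lambda>c. c *\<^sub>C q\<close>.\<close>
  have FTC: "(\<integral>s. \<i> / 2 * cis (s / 2) \<partial>lebesgue_on {0..t}) = cis (t / 2) - 1" if "0 \<le> t" for t
  proof -
    have "((\<lambda>s. \<i> / 2 * cis (s / 2)) has_integral cis (t / 2) - cis (0 / 2)) {0..t}"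
      by (rule fundamental_theorem_of_calculus[OF that])
        (auto intro!: derivative_eq_intros simp: scaleR_conv_of_real)
    then have "integral {0..t} (\<lambda>s. \<i> / 2 * cis (s / 2)) = cis (t / 2) - cis (0 / 2)"
      by (rule integral_unique)
    moreover have "(\<integral>s. \<i> / 2 * cis (s / 2) \<partial>lebesgue_on {0..t}) = integral {0..t} (\<lambda>s. \<i> / 2 * cis (s / 2))"
      by (rule lebesgue_integral_eq_integral[OF fint]) simp
    ultimately show ?thesis by (simp only:) simp
  qed
  show "H1_curve (4 * pi) L2_sphere \<gamma> \<gamma>'"
    unfolding H1_curve_def
  proof (intro conjI ballI)
    show "\<gamma> t \<in> L2_sphere" for t using q by (simp add: \<gamma>_def norm_scaleC)
    show "\<gamma>' \<in> borel_measurable (lebesgue_on {0..4 * pi})"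
      unfolding \<gamma>'_def
      by (rule borel_measurable_continuous_on[OF linear_continuous_on[OF scaleC.bounded_linear_left]])
        (rule borel_measurable_integrable[OF fint])
    show "integrable (lebesgue_on {0..4 * pi}) (\<lambda>t. (norm (\<gamma>' t))\<^sup>2)"
      by (simp add: n)
    fix t assume "t \<in> {0..4 * pi}"
    then have "(\<integral>s. \<gamma>' s \<partial>lebesgue_on {0..t}) = (cis (t / 2) - 1) *\<^sub>C q"
      unfolding \<gamma>'_def integral_bounded_linear[OF scaleC.bounded_linear_left fint] by (simp only: FTC atLeastAtMost_iff)
    then show "\<gamma> t = \<gamma> 0 + (\<integral>s. \<gamma>' s \<partial>lebesgue_on {0..t})"
      by (simp add: \<gamma>_def scaleC.diff_left)
  qed
  show "\<gamma> 0 = \<gamma> (4 * pi)" by (simp add: \<gamma>_def cis.code)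
  have "alpha (\<gamma> t) (\<gamma>' t) = 1 / 4" for t
  proof -
    have "alpha (\<gamma> t) (\<gamma>' t) = Re (cis (t / 2) * cnj (cis (t / 2)) / 2 * hprod q q) / 2"
      by (simp add: alpha_def \<gamma>_def \<gamma>'_def hprod_scaleC_left hprod_scaleC_right mult_ac)
    also have "\<dots> = 1 / 4" using hprod_self_sphere[OF q] by (simp add: cis_cnj cis_mult)
    finally show ?thesis .
  qed
  then have "action (magnetic_lagrangian alpha) k (4 * pi) \<gamma> \<gamma>' = 4 * pi * (k - 1 / 8)"
    unfolding action_def magnetic_lagrangian_def n
    by (simp only:) (simp add: power2_eq_square measure_restrict_space)
  then show "action (magnetic_lagrangian alpha) k (4 * pi) \<gamma> \<gamma>' < 0"
    using k by (simp add: mult_less_0_iff)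
qed

lemma mane_critical_value_sphere: "mane_critical_value L2_sphere alpha = 1 / 8"
proof -
  obtain q where q: "q \<in> L2_sphere" using L2_sphere_nonempty by blast
  have "{k. \<forall>T>0. \<forall>\<gamma> \<gamma>'. H1_curve T L2_sphere \<gamma> \<gamma>' \<longrightarrow> \<gamma> 0 = \<gamma> T \<longrightarrow>
      action (magnetic_lagrangian alpha) k T \<gamma> \<gamma>' \<ge> 0} = {1 / 8..}" (is "?A = _")
  proof (intro equalityI subsetI)
    fix k assume k: "k \<in> ?A"
    show "k \<in> {1 / 8..}"
    proof (rule ccontr)
      assume "k \<notin> {1 / 8..}"
      then have "k < 1 / 8" by simp
      note loop = negative_action_loop[OF this q]
      from k have "\<forall>T>0. \<forall>\<gamma> \<gamma>'. H1_curve T L2_sphere \<gamma> \<gamma>' \<longrightarrow> \<gamma> 0 = \<gamma> T \<longrightarrow>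
        action (magnetic_lagrangian alpha) k T \<gamma> \<gamma>' \<ge> 0" by simp
      from this[rule_format, OF _ loop(1,2)] loop(3) show False by simp
    qed
  qed (use action_nonneg in auto)
  then show ?thesis by (simp add: mane_critical_value_def)
qed

section \<open>Case distinction by energy\<close>

theorem theorem3p15:
  shows
    "mane_critical_value L2_sphere alpha = (oneform_norm L2_sphere sphere_tangent alpha)\<^sup>2 / 2 \<and>
     (oneform_norm L2_sphere sphere_tangent alpha)\<^sup>2 / 2 = 1 / 8 \<and>
     (\<exists>a b :: real \<Rightarrow> real. \<forall>q\<^sub>0\<in>L2_sphere. \<forall>q\<^sub>1\<in>L2_sphere. \<forall>k>0.
        (k > 1 / 8 \<longrightarrow> sphere_geodesics k q\<^sub>0 q\<^sub>1 \<noteq> {}) \<and>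
        (k = 1 / 8 \<longrightarrow> (sphere_geodesics k q\<^sub>0 q\<^sub>1 \<noteq> {} \<longleftrightarrow> hprod q\<^sub>0 q\<^sub>1 \<noteq> 0)) \<and>
        (k < 1 / 8 \<longrightarrow>
          b k > 0 \<and>
          (cmod (hprod q\<^sub>0 q\<^sub>1) > sqrt (1 - 8 * k) \<longrightarrow> sphere_geodesics k q\<^sub>0 q\<^sub>1 \<noteq> {}) \<and>
          (cmod (hprod q\<^sub>0 q\<^sub>1) = sqrt (1 - 8 * k) \<longrightarrow>
             (sphere_geodesics k q\<^sub>0 q\<^sub>1 \<noteq> {} \<longleftrightarrow>
               (\<exists>m::int. hprod q\<^sub>0 q\<^sub>1 =
                  exp (\<i> * of_real (a k + of_int m * b k)) * of_real (sqrt (1 - 8 * k))))) \<and>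
          (cmod (hprod q\<^sub>0 q\<^sub>1) < sqrt (1 - 8 * k) \<longrightarrow> sphere_geodesics k q\<^sub>0 q\<^sub>1 = {})))"
proof (intro conjI)
  show "mane_critical_value L2_sphere alpha = (oneform_norm L2_sphere sphere_tangent alpha)\<^sup>2 / 2"
    "(oneform_norm L2_sphere sphere_tangent alpha)\<^sup>2 / 2 = 1 / 8"
    by (simp_all add: mane_critical_value_sphere oneform_norm_alpha power2_eq_square)
  define \<rho> where "\<rho> k = sqrt (1 - 8 * k)" for k :: real
  have nonempty: "sphere_geodesics k q\<^sub>0 q\<^sub>1 \<noteq> {}"
    if q: "q\<^sub>0 \<in> L2_sphere" "q\<^sub>1 \<in> L2_sphere" and "0 < k" "hprod q\<^sub>0 q\<^sub>1 \<noteq> 0" "1 - 8 * k < (cmod (hprod q\<^sub>0 q\<^sub>1))\<^sup>2"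
    for k q\<^sub>0 q\<^sub>1
  proof (cases "cmod (hprod q\<^sub>0 q\<^sub>1) = 1")
    case True
    then show ?thesis using sphere_geodesics_same_line that by blast
  next
    case False
    have "cmod (hprod q\<^sub>0 q\<^sub>1) \<le> 1" using q norm_hprod_le[of q\<^sub>0 q\<^sub>1] by simp
    then show ?thesis using sphere_geodesics_nonempty[OF q] that False by simp
  qed
  show "\<exists>a b :: real \<Rightarrow> real. \<forall>q\<^sub>0\<in>L2_sphere. \<forall>q\<^sub>1\<in>L2_sphere. \<forall>k>0.
        (k > 1 / 8 \<longrightarrow> sphere_geodesics k q\<^sub>0 q\<^sub>1 \<noteq> {}) \<and>
        (k = 1 / 8 \<longrightarrow> (sphere_geodesics k q\<^sub>0 q\<^sub>1 \<noteq> {} \<longleftrightarrow> hprod q\<^sub>0 q\<^sub>1 \<noteq> 0)) \<and>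
        (k < 1 / 8 \<longrightarrow>
          b k > 0 \<and>
          (cmod (hprod q\<^sub>0 q\<^sub>1) > sqrt (1 - 8 * k) \<longrightarrow> sphere_geodesics k q\<^sub>0 q\<^sub>1 \<noteq> {}) \<and>
          (cmod (hprod q\<^sub>0 q\<^sub>1) = sqrt (1 - 8 * k) \<longrightarrow>
             (sphere_geodesics k q\<^sub>0 q\<^sub>1 \<noteq> {} \<longleftrightarrow>
               (\<exists>m::int. hprod q\<^sub>0 q\<^sub>1 =
                  exp (\<i> * of_real (a k + of_int m * b k)) * of_real (sqrt (1 - 8 * k))))) \<and>
          (cmod (hprod q\<^sub>0 q\<^sub>1) < sqrt (1 - 8 * k) \<longrightarrow> sphere_geodesics k q\<^sub>0 q\<^sub>1 = {}))"
  \<comment> \<open>The phases of the critical times in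
    \<open>sphere_geodesics_boundary_iff\<close>: an initial value and the increment from one
    critical time to the next.\<close>
  proof (rule exI[of _ "\<lambda>k. pi / (2 * \<rho> k) - pi / 2"], rule exI[of _ "\<lambda>k. pi / \<rho> k + pi"], intro ballI allI impI)
    fix q\<^sub>0 q\<^sub>1 :: L2S1 and k :: real
    assume q: "q\<^sub>0 \<in> L2_sphere" "q\<^sub>1 \<in> L2_sphere" and k: "0 < k"
    let ?h = "hprod q\<^sub>0 q\<^sub>1"
    have "sphere_geodesics k q\<^sub>0 q\<^sub>1 \<noteq> {}" if k8: "k > 1 / 8"
    proof (cases "?h = 0")
      case True
      \<comment> \<open>For orthogonal points take \<open>c = 0\<close>, so the energy equation
        gives \<open>\<omega>\<close>, and a quarter turn makes the cosine vanish.\<close>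
      define \<omega> where "\<omega> = sqrt (2 * k - 1 / 4)"
      have \<omega>: "\<omega> > 0" "\<omega>\<^sup>2 = 2 * k - 1 / 4" using k8 by (simp_all add: \<omega>_def)
      show ?thesis
        by (rule sphere_geodesics_if_hprod[OF q, of k \<omega> 0 "pi / 2 / \<omega>"])
          (use \<omega> True in \<open>simp_all flip: zero_complex.code\<close>)
    next
      case False
      then show ?thesis using nonempty[OF q k] k8 zero_le_power2[of "cmod ?h"] by simp
    qed
    moreover have "sphere_geodesics k q\<^sub>0 q\<^sub>1 \<noteq> {} \<longleftrightarrow> ?h \<noteq> 0" if "k = 1 / 8"
      using nonempty[OF q k] hprod_nonzero_if_critical_geodesic[of q\<^sub>0 q\<^sub>1] by (auto simp: that)
    moreover have "pi / \<rho> k + pi > 0 \<and>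
        (cmod ?h > sqrt (1 - 8 * k) \<longrightarrow> sphere_geodesics k q\<^sub>0 q\<^sub>1 \<noteq> {}) \<and>
        (cmod ?h = sqrt (1 - 8 * k) \<longrightarrow> (sphere_geodesics k q\<^sub>0 q\<^sub>1 \<noteq> {} \<longleftrightarrow>
          (\<exists>m::int. ?h = exp (\<i> * of_real (pi / (2 * \<rho> k) - pi / 2 + of_int m * (pi / \<rho> k + pi))) *
            of_real (sqrt (1 - 8 * k))))) \<and>
        (cmod ?h < sqrt (1 - 8 * k) \<longrightarrow> sphere_geodesics k q\<^sub>0 q\<^sub>1 = {})" if k8: "k < 1 / 8"
      unfolding \<rho>_def[symmetric]
    proof (intro conjI impI)
      have \<rho>: "0 < \<rho> k" "\<rho> k < 1" "(\<rho> k)\<^sup>2 = 1 - 8 * k" using k8 k by (simp_all add: \<rho>_def)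
      show "pi / \<rho> k + pi > 0" using \<rho> by (simp add: add_pos_pos)
      show "sphere_geodesics k q\<^sub>0 q\<^sub>1 \<noteq> {}" if "cmod ?h > \<rho> k"
      proof (rule nonempty[OF q k])
        show "?h \<noteq> 0" using that \<rho> by auto
        show "1 - 8 * k < (cmod ?h)\<^sup>2"
          unfolding \<rho>(3)[symmetric] using that \<rho> by (intro power_strict_mono) auto
      qed
      show "sphere_geodesics k q\<^sub>0 q\<^sub>1 \<noteq> {} \<longleftrightarrow>
          (\<exists>m::int. ?h = exp (\<i> * of_real (pi / (2 * \<rho> k) - pi / 2 + of_int m * (pi / \<rho> k + pi))) * of_real (\<rho> k))"
        if "cmod ?h = \<rho> k"
        using sphere_geodesics_boundary_iff[OF q \<rho>(1,2) _ that] \<rho>(3) by (simp add: cis_conv_exp)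
      show "sphere_geodesics k q\<^sub>0 q\<^sub>1 = {}" if "cmod ?h < \<rho> k"
      proof (rule ccontr)
        assume "sphere_geodesics k q\<^sub>0 q\<^sub>1 \<noteq> {}"
        from cmod_hprod_ge_if_geodesic[OF this] have "(\<rho> k)\<^sup>2 \<le> (cmod ?h)\<^sup>2" by (simp add: \<rho>(3))
        then show False using that by (simp add: power_mono_iff[of "\<rho> k"] \<rho>(1) less_imp_le)
      qed
    qed
    ultimately show "(k > 1 / 8 \<longrightarrow> sphere_geodesics k q\<^sub>0 q\<^sub>1 \<noteq> {}) \<and>
        (k = 1 / 8 \<longrightarrow> (sphere_geodesics k q\<^sub>0 q\<^sub>1 \<noteq> {} \<longleftrightarrow> ?h \<noteq> 0)) \<and>
        (k < 1 / 8 \<longrightarrow> pi / \<rho> k + pi > 0 \<and>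
        (cmod ?h > sqrt (1 - 8 * k) \<longrightarrow> sphere_geodesics k q\<^sub>0 q\<^sub>1 \<noteq> {}) \<and>
        (cmod ?h = sqrt (1 - 8 * k) \<longrightarrow> (sphere_geodesics k q\<^sub>0 q\<^sub>1 \<noteq> {} \<longleftrightarrow>
          (\<exists>m::int. ?h = exp (\<i> * of_real (pi / (2 * \<rho> k) - pi / 2 + of_int m * (pi / \<rho> k + pi))) *
            of_real (sqrt (1 - 8 * k))))) \<and>
        (cmod ?h < sqrt (1 - 8 * k) \<longrightarrow> sphere_geodesics k q\<^sub>0 q\<^sub>1 = {}))" by blast
  qed
qed

end
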